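(* Let $G$ be a finite connected amply regular graph with parameters $(n,d,\alpha,\beta)$, neither complete nor empty. If $1\ne\beta>\alpha$, then $G$ is an $(n,d,c)$-expander with $$c=1-\frac{d}{d+4+\max\left\{\alpha,\ 2\left\lceil\frac{(\beta-\alpha)\alpha}{\beta-1}\right\rceil\right\}}.$$
   Context: All graphs are simple and undirected. An amply regular graph with parameters $(n,d,\alpha,\beta)$ is a $d$-regular graph with $n$ vertices such that any two adjacent vertices have exactly $\alpha$ common neighbors and any two vertices at distance $2$ have exactly $\beta$ common neighbors. A graph $G=(V,E)$ is called an $(n,d,c)$-expander if it has $n$ vertices, the maximum degree of a vertex is $d$, and for every set of vertices $W\subset V$ with $|W|\le n/2$ one has $|N(W)|\ge c|W|$, where $N(W)$ is the set of all vertices in $V\setminus W$ adjacent to some vertex in $W$. *)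

theory Defs
  imports "Graph_Theory.Graph_Theory"
begin

text \<open>
  A finite simple undirected graph is a symmetric digraph without loops and parallel arcs
  (locale \<open>graph\<close>): an undirected edge is a pair of opposite arcs, so the degree of a
  vertex is its out-degree.
\<close>

text \<open>The minimal number of arcs of a walk from \<open>u\<close> to \<open>v\<close>, infinite if there is none.\<close>

definition graph_dist :: "('a, 'b) pre_digraph \<Rightarrow> 'a \<Rightarrow> 'a \<Rightarrow> ereal" where
  "graph_dist G u v = wf_digraph.\<mu> G (\<lambda>_. 1) u v"

definition common_nbrs :: "('a, 'b) pre_digraph \<Rightarrow> 'a \<Rightarrow> 'a \<Rightarrow> 'a set" where
  "common_nbrs G u v = {w \<in> verts G. u \<rightarrow>\<^bsub>G\<^esub> w \<and> v \<rightarrow>\<^bsub>G\<^esub> w}"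

definition amply_regular ::
  "nat \<Rightarrow> nat \<Rightarrow> nat \<Rightarrow> nat \<Rightarrow> ('a, 'b) pre_digraph \<Rightarrow> bool" where
  "amply_regular n d \<alpha> \<beta> G \<longleftrightarrow>
     graph G \<and>
     card (verts G) = n \<and>
     (\<forall>v \<in> verts G. out_degree G v = d) \<and>
     (\<forall>u \<in> verts G. \<forall>v \<in> verts G. u \<rightarrow>\<^bsub>G\<^esub> v \<longrightarrow> card (common_nbrs G u v) = \<alpha>) \<and>
     (\<forall>u \<in> verts G. \<forall>v \<in> verts G. graph_dist G u v = 2 \<longrightarrow> card (common_nbrs G u v) = \<beta>)"

definition outer_nbrs :: "('a, 'b) pre_digraph \<Rightarrow> 'a set \<Rightarrow> 'a set" where
  "outer_nbrs G W = {v \<in> verts G - W. \<exists>w \<in> W. w \<rightarrow>\<^bsub>G\<^esub> v}"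

text \<open>The maximum degree is meaningful only if there is at least one vertex.\<close>

definition expander :: "nat \<Rightarrow> nat \<Rightarrow> real \<Rightarrow> ('a, 'b) pre_digraph \<Rightarrow> bool" where
  "expander n d c G \<longleftrightarrow>
     graph G \<and>
     card (verts G) = n \<and>
     verts G \<noteq> {} \<and> Max (out_degree G ` verts G) = d \<and>
     (\<forall>W \<subseteq> verts G. real (card W) \<le> real n / 2 \<longrightarrow>
        real (card (outer_nbrs G W)) \<ge> c * real (card W))"

end

theory Submission
  imports Defs "HOL-Analysis.Henstock_Kurzweil_Integration" "HOL-Analysis.Function_Topology"
begin

text \<open>
  Let \<open>l\<close> be the least positive eigenvalue of the Laplacian. The Alon--Milman inequality turns
  \<open>l\<close> into the expansion constant \<open>2 l / (d + 2 l)\<close>, so it suffices to bound \<open>l\<close> below by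
  \<open>2 + c\<close>, with \<open>c\<close> the ceiling in the statement, and by \<open>2 + \<alpha> / 2\<close>.

  For the first bound, take an edge \<open>xy\<close> on which an eigenfunction \<open>f\<close> has the largest increment,
  normalised to \<open>1\<close>. The eigenvalue equations at \<open>x\<close> and \<open>y\<close> express \<open>l\<close> through the difference of
  the sums of \<open>f\<close> over the two neighbourhoods. Summing \<open>f v - f u \<le> 1\<close> over the edges between them
  bounds this difference; replacing \<open>f\<close> by the integer-valued \<open>\<lfloor>f + t\<rfloor>\<close> and averaging over \<open>t\<close>
  yields the ceiling, in place of an integral matching between the neighbourhoods.

  The second bound is an integrated Bakry--Emery inequality: the second differences
  \<open>f x + f z - 2 f y\<close> along the paths \<open>x - y - z\<close> are counted by midpoint and by end points, using
  Cauchy--Schwarz for the pairs \<open>x, z\<close> at distance two.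
\<close>

section \<open>Laplacian, spectral gap and expansion of regular graphs\<close>

text \<open>Neighbourhood sets replace arcs, so that sums over edges become double sums over ordered
  pairs of adjacent vertices.\<close>

locale regular_nhds =
  fixes V :: "'a set" and N :: "'a \<Rightarrow> 'a set" and d :: nat
  assumes finite_V: "finite V"
    and nhd_subset: "x \<in> V \<Longrightarrow> N x \<subseteq> V"
    and nhd_irrefl: "x \<notin> N x"
    and nhd_sym: "x \<in> V \<Longrightarrow> y \<in> N x \<Longrightarrow> x \<in> N y"
    and card_nhd: "x \<in> V \<Longrightarrow> card (N x) = d"
begin

definition lap :: "('a \<Rightarrow> real) \<Rightarrow> 'a \<Rightarrow> real" where
  "lap f x = (\<Sum>y\<in>N x. f x - f y)"

text \<open>Every edge is counted in both directions.\<close>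

definition dirichlet :: "('a \<Rightarrow> real) \<Rightarrow> real" where
  "dirichlet f = (\<Sum>x\<in>V. \<Sum>y\<in>N x. (f x - f y)\<^sup>2)"

definition bdry :: "'a set \<Rightarrow> 'a set" where
  "bdry W = {v \<in> V - W. \<exists>w\<in>W. v \<in> N w}"

lemma finite_nhd: "x \<in> V \<Longrightarrow> finite (N x)"
  using finite_V nhd_subset finite_subset by blast

lemma nhd_in_V: "x \<in> V \<Longrightarrow> y \<in> N x \<Longrightarrow> y \<in> V"
  using nhd_subset by blast

lemma nhd_sym_iff: "x \<in> V \<Longrightarrow> y \<in> V \<Longrightarrow> x \<in> N y \<longleftrightarrow> y \<in> N x"
  using nhd_sym by blast

lemma sum_nhd_swap:
  fixes h :: "'a \<Rightarrow> 'a \<Rightarrow> real"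
  shows "(\<Sum>x\<in>V. \<Sum>y\<in>N x. h x y) = (\<Sum>x\<in>V. \<Sum>y\<in>N x. h y x)"
proof -
  have 1: "N x = {y \<in> V. y \<in> N x}" and 2: "N x = {y \<in> V. x \<in> N y}" if "x \<in> V" for x
    using that nhd_in_V nhd_sym_iff by blast+
  have "(\<Sum>x\<in>V. \<Sum>y\<in>N x. h x y) = (\<Sum>x\<in>V. \<Sum>y\<in>{y \<in> V. y \<in> N x}. h x y)"
    using 1 by (intro sum.cong) auto
  also have "\<dots> = (\<Sum>y\<in>V. \<Sum>x\<in>{x \<in> V. y \<in> N x}. h x y)"
    by (rule sum.swap_restrict[OF finite_V finite_V])
  also have "\<dots> = (\<Sum>x\<in>V. \<Sum>y\<in>N x. h y x)"
    using 2 by (intro sum.cong) auto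
  finally show ?thesis .
qed

text \<open>Discrete Green formula: split the factor \<open>g x - g y\<close> and reverse the edges
  in one half by \<open>sum_nhd_swap\<close>.\<close>

lemma sum_lap_mult:
  "(\<Sum>x\<in>V. \<Sum>y\<in>N x. (f x - f y) * (g x - g y)) = 2 * (\<Sum>x\<in>V. lap f x * g x)"
proof -
  have "(\<Sum>x\<in>V. \<Sum>y\<in>N x. (f x - f y) * (g x - g y))
      = (\<Sum>x\<in>V. \<Sum>y\<in>N x. (f x - f y) * g x) - (\<Sum>x\<in>V. \<Sum>y\<in>N x. (f x - f y) * g y)"
    by (simp add: sum_subtractf[symmetric] algebra_simps)
  also have "(\<Sum>x\<in>V. \<Sum>y\<in>N x. (f x - f y) * g y) = (\<Sum>x\<in>V. \<Sum>y\<in>N x. (f y - f x) * g x)"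
    by (rule sum_nhd_swap)
  also have "\<dots> = - (\<Sum>x\<in>V. \<Sum>y\<in>N x. (f x - f y) * g x)"
    by (simp add: sum_negf[symmetric] algebra_simps)
  finally show ?thesis
    by (simp add: lap_def sum_distrib_right)
qed

lemma dirichlet_eq_lap: "dirichlet f = 2 * (\<Sum>x\<in>V. lap f x * f x)"
  using sum_lap_mult[of f f] by (simp add: dirichlet_def power2_eq_square)

lemma sum_lap: "(\<Sum>x\<in>V. lap f x) = 0"
  using sum_lap_mult[of f "\<lambda>_. 1"] by simp

lemma dirichlet_add:
  "dirichlet (\<lambda>x. f x + t * g x)
     = dirichlet f + 4 * t * (\<Sum>x\<in>V. lap f x * g x) + t\<^sup>2 * dirichlet g"
proof -
  have "dirichlet (\<lambda>x. f x + t * g x) = (\<Sum>x\<in>V. \<Sum>y\<in>N x. (f x - f y)\<^sup>2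
     + 2 * t * ((f x - f y) * (g x - g y)) + t\<^sup>2 * (g x - g y)\<^sup>2)"
    unfolding dirichlet_def by (intro sum.cong refl) (simp add: power2_eq_square algebra_simps)
  also have "\<dots> = dirichlet f + 2 * t * (\<Sum>x\<in>V. \<Sum>y\<in>N x. (f x - f y) * (g x - g y))
      + t\<^sup>2 * dirichlet g"
    unfolding dirichlet_def by (simp add: sum.distrib sum_distrib_left)
  finally show ?thesis
    by (simp add: sum_lap_mult)
qed

lemma dirichlet_scale: "dirichlet (\<lambda>x. c * f x) = c\<^sup>2 * dirichlet f"
  unfolding dirichlet_def sum_distrib_left
  by (intro sum.cong refl) (simp add: power_mult_distrib flip: right_diff_distrib)

lemma dirichlet_cong: "(\<And>x. x \<in> V \<Longrightarrow> f x = g x) \<Longrightarrow> dirichlet f = dirichlet g"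
  unfolding dirichlet_def by (intro sum.cong refl) (auto dest: nhd_in_V)

text \<open>The Rayleigh quotient attains its minimum by compactness; scaling carries the inequality
  from unit vectors to every \<open>g\<close> with sum zero.\<close>

lemma dirichlet_minimizer:
  assumes "a \<in> V" "b \<in> V" "a \<noteq> b"
  obtains f where "(\<Sum>x\<in>V. f x) = 0" "(\<Sum>x\<in>V. (f x)\<^sup>2) = 1"
    "\<And>g. (\<Sum>x\<in>V. g x) = 0 \<Longrightarrow> dirichlet f * (\<Sum>x\<in>V. (g x)\<^sup>2) \<le> dirichlet g"
proof -
  \<comment> \<open>Functions live on the whole type, so values off \<open>V\<close> are fixed to 0.
    The box is compact by Tychonoff's theorem and contains the truncation to \<open>V\<close> of
    every normalised function.\<close>
  define B :: "('a \<Rightarrow> real) set" where "B = PiE UNIV (\<lambda>x. if x \<in> V then {-1..1} else {0})"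
  define S where "S = B \<inter> {f. (\<Sum>x\<in>V. f x) = 0} \<inter> {f. (\<Sum>x\<in>V. (f x)\<^sup>2) = 1}"
  have "compactin (product_topology (\<lambda>_. euclidean) (UNIV :: 'a set)) B"
    unfolding B_def compactin_PiE by auto
  then have "compact B"
    by (simp add: euclidean_product_topology)
  moreover have "closed {f :: 'a \<Rightarrow> real. (\<Sum>x\<in>V. f x) = 0}"
    by (intro closed_Collect_eq continuous_intros continuous_on_product_coordinates)
  moreover have "closed {f :: 'a \<Rightarrow> real. (\<Sum>x\<in>V. (f x)\<^sup>2) = 1}"
    by (intro closed_Collect_eq continuous_intros continuous_on_product_coordinates)
  ultimately have compact: "compact S"
    unfolding S_def by (intro compact_Int_closed)
  have cont: "continuous_on S dirichlet"
    unfolding dirichlet_def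
    by (intro continuous_intros continuous_on_subset[OF continuous_on_product_coordinates]) auto
  have normalized: "(\<lambda>x. if x \<in> V then c * g x else 0) \<in> S"
    if "(\<Sum>x\<in>V. g x) = 0" "c\<^sup>2 * (\<Sum>x\<in>V. (g x)\<^sup>2) = 1" for c g
  proof -
    have 1: "(\<Sum>x\<in>V. (c * g x)\<^sup>2) = 1"
      using that by (simp add: power_mult_distrib sum_distrib_left)
    have "(c * g x)\<^sup>2 \<le> 1" if "x \<in> V" for x
      using member_le_sum[of x V "\<lambda>x. (c * g x)\<^sup>2"] that finite_V 1 by simp
    then have "\<bar>c * g x\<bar> \<le> 1" if "x \<in> V" for x
      using that abs_square_le_1 by blast
    moreover have "(\<Sum>x\<in>V. c * g x) = 0"
      using that by (simp flip: sum_distrib_left)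
    ultimately show ?thesis
      using 1 unfolding S_def B_def by (auto simp: abs_le_iff cong: sum.cong)
  qed
  have "S \<noteq> {}"
  proof -
    \<comment> \<open>The squared norm of this function is 2, whence the scaling by
      \<open>1 / sqrt 2\<close>.\<close>
    define g :: "'a \<Rightarrow> real" where "g x = of_bool (x = a) - of_bool (x = b)" for x
    have g2: "(g x)\<^sup>2 = of_bool (x = a) + of_bool (x = b)" for x
      using assms by (auto simp: g_def)
    have "(\<Sum>x\<in>V. g x) = 0" "(1 / sqrt 2)\<^sup>2 * (\<Sum>x\<in>V. (g x)\<^sup>2) = 1"
      unfolding g2 unfolding g_def using assms finite_V
      by (simp_all add: sum.distrib sum_subtractf power_divide of_bool_def)
    then show ?thesis
      using normalized by blast
  qed
  then obtain f where f: "f \<in> S" and min: "\<And>g. g \<in> S \<Longrightarrow> dirichlet f \<le> dirichlet g"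
    using continuous_attains_inf[OF compact _ cont] by blast
  show ?thesis
  proof
    show "(\<Sum>x\<in>V. f x) = 0" "(\<Sum>x\<in>V. (f x)\<^sup>2) = 1"
      using f by (auto simp: S_def)
  next
    fix g :: "'a \<Rightarrow> real"
    assume g: "(\<Sum>x\<in>V. g x) = 0"
    define s where "s = (\<Sum>x\<in>V. (g x)\<^sup>2)"
    show "dirichlet f * (\<Sum>x\<in>V. (g x)\<^sup>2) \<le> dirichlet g"
    proof (cases "s = 0")
      case True
      then show ?thesis
        by (simp add: s_def dirichlet_def sum_nonneg)
    next
      case False
      moreover have "s \<ge> 0"
        by (simp add: s_def sum_nonneg)
      ultimately have "s > 0"
        by simp
      then have *: "(1 / sqrt s)\<^sup>2 * (\<Sum>x\<in>V. (g x)\<^sup>2) = 1"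
        by (simp add: power_divide flip: s_def)
      have "dirichlet f \<le> dirichlet (\<lambda>x. if x \<in> V then 1 / sqrt s * g x else 0)"
        by (intro min normalized g *)
      also have "\<dots> = dirichlet (\<lambda>x. 1 / sqrt s * g x)"
        by (rule dirichlet_cong) simp
      also have "\<dots> = dirichlet g / s"
        using \<open>s > 0\<close> unfolding dirichlet_scale by (simp add: power_divide)
      finally show ?thesis
        using \<open>s > 0\<close> by (simp add: s_def field_simps)
    qed
  qed
qed

text \<open>First variation at the minimiser: move \<open>f\<close> along its residual
  \<open>h\<close>, which again has sum zero. The first-order term is a multiple of the squared norm
  \<open>s\<close> of \<open>h\<close>, so minimality forces \<open>s = 0\<close>.\<close>

lemma spectral_gap:
  assumes "a \<in> V" "b \<in> V" "a \<noteq> b"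
  obtains f l where "(\<Sum>x\<in>V. f x) = 0" "(\<Sum>x\<in>V. (f x)\<^sup>2) = 1"
    "\<And>x. x \<in> V \<Longrightarrow> lap f x = l * f x"
    "\<And>g. (\<Sum>x\<in>V. g x) = 0 \<Longrightarrow> 2 * l * (\<Sum>x\<in>V. (g x)\<^sup>2) \<le> dirichlet g"
proof -
  obtain f where f: "(\<Sum>x\<in>V. f x) = 0" "(\<Sum>x\<in>V. (f x)\<^sup>2) = 1"
    and min: "\<And>g. (\<Sum>x\<in>V. g x) = 0 \<Longrightarrow> dirichlet f * (\<Sum>x\<in>V. (g x)\<^sup>2) \<le> dirichlet g"
    using dirichlet_minimizer[OF assms] by blast
  define l where "l = dirichlet f / 2"
  define h where "h x = lap f x - l * f x" for x
  define s where "s = (\<Sum>x\<in>V. (h x)\<^sup>2)"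
  have sum_h: "(\<Sum>x\<in>V. h x) = 0"
    using f sum_lap[of f] by (simp add: h_def sum_subtractf flip: sum_distrib_left)
  have s_eq: "s = (\<Sum>x\<in>V. lap f x * h x) - l * (\<Sum>x\<in>V. f x * h x)"
    unfolding s_def sum_distrib_left sum_subtractf[symmetric]
    by (intro sum.cong refl) (simp add: h_def power2_eq_square algebra_simps)
  have quadratic: "0 \<le> 4 * t * s + t\<^sup>2 * (dirichlet h - 2 * l * s)" for t
  proof -
    have "(\<Sum>x\<in>V. (f x + t * h x)) = 0"
      using f sum_h by (simp add: sum.distrib flip: sum_distrib_left)
    from min[OF this] have "2 * l * (\<Sum>x\<in>V. (f x + t * h x)\<^sup>2) \<le> dirichlet (\<lambda>x. f x + t * h x)"
      by (simp add: l_def)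
    moreover have "(\<Sum>x\<in>V. (f x + t * h x)\<^sup>2) = 1 + 2 * t * (\<Sum>x\<in>V. f x * h x) + t\<^sup>2 * s"
    proof -
      have "(\<Sum>x\<in>V. (f x + t * h x)\<^sup>2) = (\<Sum>x\<in>V. (f x)\<^sup>2 + 2 * t * (f x * h x) + t\<^sup>2 * (h x)\<^sup>2)"
        by (intro sum.cong refl) (simp add: power2_eq_square algebra_simps)
      then show ?thesis
        by (simp add: sum.distrib f s_def flip: sum_distrib_left)
    qed
    ultimately show ?thesis
      by (simp add: dirichlet_add s_eq l_def algebra_simps)
  qed
  have "s = 0"
  proof (rule ccontr)
    assume "s \<noteq> 0"
    moreover have "s \<ge> 0"
      by (simp add: s_def sum_nonneg)
    ultimately have "s > 0"
      by simp
    \<comment> \<open>At \<open>t = - s / c\<close> the linear term outweighs the quadratic one;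
      adding 1 keeps \<open>c\<close> positive.\<close>
    define c where "c = \<bar>dirichlet h - 2 * l * s\<bar> + 1"
    have c: "c > 0" "dirichlet h - 2 * l * s \<le> c"
      by (auto simp: c_def)
    have "0 \<le> 4 * (- s / c) * s + (- s / c)\<^sup>2 * (dirichlet h - 2 * l * s)"
      by (rule quadratic)
    also have "\<dots> \<le> 4 * (- s / c) * s + (- s / c)\<^sup>2 * c"
      using c by (intro add_left_mono mult_left_mono) auto
    also have "\<dots> = - 3 * s\<^sup>2 / c"
      using c by (simp add: power2_eq_square field_simps)
    also have "\<dots> < 0"
      using c \<open>s > 0\<close> by (simp add: divide_neg_pos)
    finally show False
      by simp
  qed
  then have "lap f x = l * f x" if "x \<in> V" for x
    using that finite_V by (simp add: s_def h_def sum_nonneg_eq_0_iff)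
  moreover have "2 * l * (\<Sum>x\<in>V. (g x)\<^sup>2) \<le> dirichlet g" if "(\<Sum>x\<in>V. g x) = 0" for g
    using min[OF that] by (simp add: l_def)
  ultimately show ?thesis
    using f that by blast
qed

text \<open>The Alon--Milman argument: no edge joins \<open>W\<close> to the rest \<open>U\<close>
  outside \<open>bdry W\<close>, so a function constant on \<open>W\<close> and on \<open>U\<close>
  varies only along edges that meet \<open>bdry W\<close>. Solved for the boundary, the bound has
  the factor \<open>2 * l / (d + 2 * l)\<close>.\<close>

lemma bdry_bound_of_spectral_gap:
  fixes l :: real
  assumes gap: "\<And>g. (\<Sum>x\<in>V. g x) = 0 \<Longrightarrow> 2 * l * (\<Sum>x\<in>V. (g x)\<^sup>2) \<le> dirichlet g"
    and "l \<ge> 0" and W: "W \<subseteq> V" "2 * card W \<le> card V"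
  shows "2 * l * (real (card W) - real (card (bdry W))) \<le> real d * real (card (bdry W))"
proof -
  define U where "U = V - W - bdry W"
  define A B n where "A = real (card W)" and "B = real (card U)" and "n = real (card (bdry W))"
  have bV: "bdry W \<subseteq> V" and disj: "W \<inter> bdry W = {}" "W \<inter> U = {}" "bdry W \<inter> U = {}"
    and un: "V = W \<union> bdry W \<union> U"
    using W by (auto simp: bdry_def U_def)
  have fin: "finite W" "finite U" "finite (bdry W)"
    using finite_V un by (metis finite_Un)+
  have card_V: "real (card V) = A + n + B"
  proof -
    have "card (W \<union> bdry W \<union> U) = card W + card (bdry W) + card U"
      using fin disj by (simp add: card_Un_disjoint Int_Un_distrib2)
    then show ?thesis
      by (simp add: A_def B_def n_def flip: un)
  qed
  have half: "2 * A \<le> A + n + B"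
    using W(2) card_V by (simp add: A_def)
  show ?thesis
  proof (cases "A \<le> n")
    case True
    then have "2 * l * (A - n) \<le> 0"
      using \<open>l \<ge> 0\<close> by (simp add: mult_nonneg_nonpos)
    then show ?thesis
      by (smt (verit) A_def n_def of_nat_0_le_iff mult_nonneg_nonneg)
  next
    case False
    \<comment> \<open>From \<open>n < A\<close> and \<open>2 * A \<le> A + n + B\<close> it follows
      that \<open>U\<close> is nonempty.\<close>
    then have pos: "A > 0" "B > 0" "n \<ge> 0"
      using half by (auto simp: n_def)
    define s where "s = 1 / A + 1 / B"
    \<comment> \<open>The value on the boundary is the midpoint of the other two, so an edge meeting
      the boundary has increment 0 or at most \<open>s / 2\<close> in size. Subtracting the mean
      \<open>m\<close> changes no increment.\<close>
    define g0 where "g0 x = (if x \<in> W then 1 / A else if x \<in> bdry W then (1 / A - 1 / B) / 2 else - 1 / B)"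
      for x
    define m where "m = (\<Sum>x\<in>V. g0 x) / card V"
    define g where "g x = g0 x - m" for x
    have "card V > 0"
      using pos card_V by linarith
    then have "(\<Sum>x\<in>V. g x) = 0"
      by (simp add: g_def m_def sum_subtractf)
    then have "2 * l * (\<Sum>x\<in>V. (g x)\<^sup>2) \<le> dirichlet g"
      by (rule gap)
    also have "dirichlet g \<le> (\<Sum>x\<in>V. \<Sum>y\<in>N x. s\<^sup>2 / 4 * (of_bool (x \<in> bdry W) + of_bool (y \<in> bdry W)))"
      unfolding dirichlet_def
    proof (intro sum_mono)
      fix x y assume xy: "x \<in> V" "y \<in> N x"
      then have "x \<in> N y" "y \<in> V"
        using nhd_sym[OF xy] nhd_in_V[OF xy] by simp_all
      then consider "x \<in> bdry W" | "y \<in> bdry W" | "x \<notin> bdry W" "y \<notin> bdry W" "x \<in> W \<longleftrightarrow> y \<in> W"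
        using xy unfolding bdry_def by blast
      then show "(g x - g y)\<^sup>2 \<le> s\<^sup>2 / 4 * (of_bool (x \<in> bdry W) + of_bool (y \<in> bdry W))"
      proof cases
        case 1
        then have "g x - g y \<in> {0, s / 2, - s / 2}"
          using disj by (auto simp: g_def g0_def s_def field_simps)
        then have "\<bar>g x - g y\<bar> \<le> \<bar>s / 2\<bar>"
          by (elim insertE emptyE) linarith+
        then have "(g x - g y)\<^sup>2 \<le> (s / 2)\<^sup>2"
          by (simp only: abs_le_square_iff)
        then have "(g x - g y)\<^sup>2 \<le> s\<^sup>2 / 4"
          by (simp add: power_divide)
        also have "\<dots> \<le> s\<^sup>2 / 4 * (of_bool (x \<in> bdry W) + of_bool (y \<in> bdry W))"
          using 1 by simp
        finally show ?thesis .
      next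
        case 2
        then have "g x - g y \<in> {0, s / 2, - s / 2}"
          using disj by (auto simp: g_def g0_def s_def field_simps)
        then have "\<bar>g x - g y\<bar> \<le> \<bar>s / 2\<bar>"
          by (elim insertE emptyE) linarith+
        then have "(g x - g y)\<^sup>2 \<le> (s / 2)\<^sup>2"
          by (simp only: abs_le_square_iff)
        then have "(g x - g y)\<^sup>2 \<le> s\<^sup>2 / 4"
          by (simp add: power_divide)
        also have "\<dots> \<le> s\<^sup>2 / 4 * (of_bool (x \<in> bdry W) + of_bool (y \<in> bdry W))"
          using 2 by simp
        finally show ?thesis .
      next
        case 3
        then show ?thesis
          by (auto simp: g_def g0_def)
      qed
    qed
    also have "\<dots> = s\<^sup>2 / 4 * ((\<Sum>x\<in>V. \<Sum>y\<in>N x. of_bool (x \<in> bdry W)) + (\<Sum>x\<in>V. \<Sum>y\<in>N x. of_bool (y \<in> bdry W)))"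
      by (simp only: sum.distrib flip: sum_distrib_left)
    also have "(\<Sum>x\<in>V. \<Sum>y\<in>N x. of_bool (y \<in> bdry W)) = (\<Sum>x\<in>V. \<Sum>y\<in>N x. of_bool (x \<in> bdry W) :: real)"
      by (rule sum_nhd_swap)
    also have "(\<Sum>x\<in>V. \<Sum>y\<in>N x. of_bool (x \<in> bdry W)) = real d * (\<Sum>x\<in>V. of_bool (x \<in> bdry W))"
      by (simp add: card_nhd sum_distrib_left)
    also have "(\<Sum>x\<in>V. of_bool (x \<in> bdry W)) = n"
      using finite_V bV by (simp add: of_bool_def sum.If_cases Int_absorb1 n_def flip: Collect_mem_eq)
    finally have upper: "2 * l * (\<Sum>x\<in>V. (g x)\<^sup>2) \<le> s\<^sup>2 / 2 * (d * n)"
      by (simp add: mult_ac)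
    have "s \<le> (\<Sum>x\<in>V. (g x)\<^sup>2)"
    proof -
      \<comment> \<open>The cross terms in \<open>m\<close> from \<open>W\<close> and
        \<open>U\<close> cancel, so recentring can only increase the squared norm there.\<close>
      have "s \<le> s + (A + B) * m\<^sup>2"
        using pos by simp
      also have "\<dots> = A * (1 / A - m)\<^sup>2 + B * (- 1 / B - m)\<^sup>2"
        using pos by (simp add: s_def power2_eq_square field_simps)
      also have "\<dots> = (\<Sum>x\<in>W. (g x)\<^sup>2) + (\<Sum>x\<in>U. (g x)\<^sup>2)"
      proof -
        have "(\<Sum>x\<in>W. (g x)\<^sup>2) = A * (1 / A - m)\<^sup>2"
          by (simp add: g_def g0_def A_def)
        moreover have "(\<Sum>x\<in>U. (g x)\<^sup>2) = (\<Sum>x\<in>U. (- 1 / B - m)\<^sup>2)"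
          using disj by (intro sum.cong refl) (auto simp: g_def g0_def)
        ultimately show ?thesis
          by (simp add: B_def)
      qed
      also have "\<dots> = (\<Sum>x\<in>W \<union> U. (g x)\<^sup>2)"
        using fin disj by (simp add: sum.union_disjoint)
      also have "\<dots> \<le> (\<Sum>x\<in>V. (g x)\<^sup>2)"
        using W finite_V by (intro sum_mono2) (auto simp: U_def)
      finally show ?thesis .
    qed
    then have "2 * l * s \<le> s\<^sup>2 / 2 * (d * n)"
      using upper \<open>l \<ge> 0\<close> by (smt (verit) mult_left_mono)
    moreover have "s > 0"
      using pos by (simp add: s_def add_pos_pos)
    ultimately have "4 * l \<le> s * (d * n)"
      by (simp add: power2_eq_square field_simps)
    then have "4 * l * (A * B) \<le> s * (d * n) * (A * B)"
      using pos by (intro mult_right_mono) auto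
    also have "\<dots> = d * n * (A + B)"
      using pos by (simp add: s_def field_simps)
    finally have "4 * l * (A * B) \<le> d * n * (A + B)" .
    moreover have "2 * l * ((A - n) * (A + B)) \<le> 2 * l * (2 * (A * B))"
    proof -
      \<comment> \<open>Here the size restriction on \<open>W\<close> enters once more, as
        \<open>A \<le> n + B\<close>.\<close>
      have "0 \<le> A * (n + B - A) + n * B"
        using pos half by simp
      then have "(A - n) * (A + B) \<le> 2 * (A * B)"
        by (simp add: algebra_simps)
      then show ?thesis
        using \<open>l \<ge> 0\<close> by (intro mult_left_mono) auto
    qed
    ultimately have "2 * l * (A - n) * (A + B) \<le> d * n * (A + B)"
      by (simp add: algebra_simps)
    then show ?thesis
      using pos by (simp add: A_def n_def)
  qed
qed

end

section \<open>Transport between the neighbourhoods of adjacent vertices\<close>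

text \<open>Distance two is expressed without walks, as distinct, non-adjacent and with a common
  neighbour; \<open>graph_dist_eq_2\<close> links this to \<open>graph_dist\<close>.\<close>

locale amply_nhds = regular_nhds +
  fixes \<alpha> \<beta> :: nat
  assumes card_common_adj: "x \<in> V \<Longrightarrow> y \<in> N x \<Longrightarrow> card (N x \<inter> N y) = \<alpha>"
    and card_common_dist2:
      "x \<in> V \<Longrightarrow> y \<in> V \<Longrightarrow> x \<noteq> y \<Longrightarrow> y \<notin> N x \<Longrightarrow> N x \<inter> N y \<noteq> {} \<Longrightarrow> card (N x \<inter> N y) = \<beta>"
begin

text \<open>The vertex \<open>y\<close> is itself a common neighbour of \<open>x\<close> and
  \<open>v\<close>, which puts \<open>v\<close> at distance at most two from \<open>x\<close>;
  deleting it accounts for the -1.\<close>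

lemma card_common_minus:
  assumes "x \<in> V" "y \<in> N x" "v \<in> N y" "v \<noteq> x"
  shows "real (card ((N x - {y}) \<inter> N v)) = (if v \<in> N x then real \<alpha> - 1 else real \<beta> - 1)"
proof -
  have yV: "y \<in> V" and vV: "v \<in> V"
    using assms nhd_in_V by blast+
  have y: "y \<in> N x \<inter> N v"
    using assms nhd_sym[OF yV] by blast
  have "card (N x \<inter> N v) = (if v \<in> N x then \<alpha> else \<beta>)"
    using assms y card_common_adj card_common_dist2[OF \<open>x \<in> V\<close> vV] by auto
  moreover have "(N x - {y}) \<inter> N v = (N x \<inter> N v) - {y}"
    by blast
  moreover have "card (N x \<inter> N v) = Suc (card ((N x \<inter> N v) - {y}))"
    using y finite_nhd[OF \<open>x \<in> V\<close>] by (intro card.remove) auto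
  ultimately show ?thesis
    by (auto split: if_splits)
qed

text \<open>
  Summing \<open>f v - f u \<le> 1\<close> over all edges between the punctured neighbourhoods of \<open>x\<close> and \<open>y\<close>:
  a common neighbour of \<open>x\<close> and \<open>y\<close> is met by \<open>\<alpha> - 1\<close> of these edges, any other vertex by \<open>\<beta> - 1\<close>.
\<close>

lemma transport_bound:
  fixes f :: "'a \<Rightarrow> real"
  assumes x: "x \<in> V" and y: "y \<in> N x"
    and lip: "\<And>u v. u \<in> V \<Longrightarrow> v \<in> N u \<Longrightarrow> f v - f u \<le> 1"
  shows "(real \<beta> - 1) * ((\<Sum>v\<in>N y - {x}. f v) - (\<Sum>u\<in>N x - {y}. f u))
           \<le> (real \<beta> - 1) * (real d - 1) - real \<alpha> * (real \<beta> - real \<alpha>)"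
proof -
  define X where "X = N x - {y}"
  define Y where "Y = N y - {x}"
  define C where "C = N x \<inter> N y"
  have yV: "y \<in> V" and x': "x \<in> N y"
    using x y nhd_in_V nhd_sym by blast+
  have fin: "finite X" "finite Y"
    using finite_nhd x yV by (auto simp: X_def Y_def)
  have XV: "X \<subseteq> V" and YV: "Y \<subseteq> V"
    using nhd_subset x yV by (auto simp: X_def Y_def)
  have CX: "C \<subseteq> X" and CY: "C \<subseteq> Y"
    using nhd_irrefl by (auto simp: X_def Y_def C_def)
  have card_X: "real (card X) = real d - 1" and card_Y: "real (card Y) = real d - 1"
    using card.remove[OF finite_nhd[OF x] y] card.remove[OF finite_nhd[OF yV] x']
      card_nhd x yV by (simp_all add: X_def Y_def)
  have card_C: "card C = \<alpha>"
    using card_common_adj x y by (simp add: C_def)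
  have wY: "real (card (X \<inter> N v)) = (real \<beta> - 1) - (real \<beta> - real \<alpha>) * of_bool (v \<in> C)" if "v \<in> Y" for v
    using card_common_minus[OF x y, of v] that by (auto simp: X_def Y_def C_def)
  have wX: "real (card (Y \<inter> N u)) = (real \<beta> - 1) - (real \<beta> - real \<alpha>) * of_bool (u \<in> C)" if "u \<in> X" for u
    using card_common_minus[OF yV x', of u] that by (auto simp: X_def Y_def C_def)
  have weighted: "(\<Sum>v\<in>S. ((real \<beta> - 1) - (real \<beta> - real \<alpha>) * of_bool (v \<in> C)) * h v)
      = (real \<beta> - 1) * sum h S - (real \<beta> - real \<alpha>) * sum h C"
    if "C \<subseteq> S" "finite S" for h :: "'a \<Rightarrow> real" and S
  proof -
    have "(\<Sum>v\<in>S. of_bool (v \<in> C) * h v) = sum h C"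
      using that by (simp add: of_bool_def if_distrib[of "\<lambda>c. c * _"] sum.If_cases Int_absorb1 cong: if_cong)
    then show ?thesis
      by (simp add: left_diff_distrib sum_subtractf mult.assoc flip: sum_distrib_left)
  qed
  have "(\<Sum>v\<in>Y. \<Sum>u\<in>X \<inter> N v. f v - f u) \<le> (\<Sum>v\<in>Y. \<Sum>u\<in>X \<inter> N v. 1)"
    using YV XV nhd_sym lip by (intro sum_mono) blast
  also have "\<dots> = (\<Sum>v\<in>Y. ((real \<beta> - 1) - (real \<beta> - real \<alpha>) * of_bool (v \<in> C)) * 1)"
    by (simp add: wY)
  also have "\<dots> = (real \<beta> - 1) * (real d - 1) - real \<alpha> * (real \<beta> - real \<alpha>)"
    by (subst weighted[OF CY fin(2)]) (simp add: card_Y card_C)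
  finally have "(\<Sum>v\<in>Y. \<Sum>u\<in>X \<inter> N v. f v - f u)
      \<le> (real \<beta> - 1) * (real d - 1) - real \<alpha> * (real \<beta> - real \<alpha>)" .
  \<comment> \<open>This sum and the next carry the same correction over \<open>C\<close>, which
    cancels in their difference.\<close>
  moreover have "(\<Sum>v\<in>Y. \<Sum>u\<in>X \<inter> N v. f v) = (real \<beta> - 1) * sum f Y - (real \<beta> - real \<alpha>) * sum f C"
    using weighted[OF CY fin(2), of f] by (simp add: wY)
  moreover have "(\<Sum>v\<in>Y. \<Sum>u\<in>X \<inter> N v. f u) = (real \<beta> - 1) * sum f X - (real \<beta> - real \<alpha>) * sum f C"
  proof -
    have "(\<Sum>v\<in>Y. \<Sum>u\<in>X \<inter> N v. f u) = (\<Sum>v\<in>Y. \<Sum>u\<in>{u \<in> X. u \<in> N v}. f u)"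
      by (simp add: Int_def)
    also have "\<dots> = (\<Sum>u\<in>X. \<Sum>v\<in>{v \<in> Y. u \<in> N v}. f u)"
      by (rule sum.swap_restrict[OF fin(2,1)])
    also have "\<dots> = (\<Sum>u\<in>X. real (card (Y \<inter> N u)) * f u)"
    proof (rule sum.cong)
      fix u assume "u \<in> X"
      then have "{v \<in> Y. u \<in> N v} = Y \<inter> N u"
        using nhd_sym XV YV by blast
      then show "(\<Sum>v\<in>{v \<in> Y. u \<in> N v}. f u) = real (card (Y \<inter> N u)) * f u"
        by simp
    qed simp
    also have "\<dots> = (real \<beta> - 1) * sum f X - (real \<beta> - real \<alpha>) * sum f C"
      using weighted[OF CX fin(1), of f] by (simp add: wX)
    finally show ?thesis .
  qed
  ultimately show ?thesis
    by (simp add: sum_subtractf algebra_simps X_def Y_def)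
qed

end

text \<open>On the unit interval the floor jumps once, by 1, at \<open>t = 1 - frac a\<close>; the
  lengths of the two pieces weigh the two values to \<open>a\<close>.\<close>

lemma has_integral_floor_add:
  "((\<lambda>t. real_of_int \<lfloor>a + t\<rfloor>) has_integral a) {0..1}"
proof -
  define c where "c = 1 - frac a"
  have c: "0 \<le> c" "c \<le> 1" "a = \<lfloor>a\<rfloor> + (1 - c)"
    using frac_lt_1[of a] frac_ge_0[of a] by (auto simp: c_def frac_def)
  have "((\<lambda>t. real_of_int \<lfloor>a + t\<rfloor>) has_integral (c - 0) *\<^sub>R real_of_int \<lfloor>a\<rfloor>) {0..c}"
  proof (rule has_integral_spike_finite[of "{c}"])
    show "((\<lambda>t. real_of_int \<lfloor>a\<rfloor>) has_integral (c - 0) *\<^sub>R real_of_int \<lfloor>a\<rfloor>) {0..c}"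
      using has_integral_const_real[of "real_of_int \<lfloor>a\<rfloor>" 0 c] c by simp
    show "real_of_int \<lfloor>a + t\<rfloor> = real_of_int \<lfloor>a\<rfloor>" if "t \<in> {0..c} - {c}" for t
      using that c by (auto simp: floor_eq_iff)
  qed simp
  moreover have "((\<lambda>t. real_of_int \<lfloor>a + t\<rfloor>) has_integral (1 - c) *\<^sub>R (real_of_int \<lfloor>a\<rfloor> + 1)) {c..1}"
  proof (rule has_integral_eq)
    show "((\<lambda>t. real_of_int \<lfloor>a\<rfloor> + 1) has_integral (1 - c) *\<^sub>R (real_of_int \<lfloor>a\<rfloor> + 1)) {c..1}"
      using has_integral_const_real[of "real_of_int \<lfloor>a\<rfloor> + 1" c 1] c by simp
    show "real_of_int \<lfloor>a\<rfloor> + 1 = real_of_int \<lfloor>a + t\<rfloor>" if "t \<in> {c..1}" for t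
    proof -
      have "\<lfloor>a + t\<rfloor> = \<lfloor>a\<rfloor> + 1"
        using that c frac_lt_1[of a] by (auto simp: floor_eq_iff c_def)
      then show ?thesis
        by simp
    qed
  qed
  ultimately have "((\<lambda>t. real_of_int \<lfloor>a + t\<rfloor>) has_integral
      (c - 0) *\<^sub>R real_of_int \<lfloor>a\<rfloor> + (1 - c) *\<^sub>R (real_of_int \<lfloor>a\<rfloor> + 1)) {0..1}"
    by (rule has_integral_combine[OF c(1,2)])
  moreover have "(c - 0) *\<^sub>R real_of_int \<lfloor>a\<rfloor> + (1 - c) *\<^sub>R (real_of_int \<lfloor>a\<rfloor> + 1) = a"
    using c(3) by (simp add: algebra_simps)
  ultimately show ?thesis
    by simp
qed

text \<open>The average of \<open>\<lfloor>f + t\<rfloor>\<close> over \<open>t \<in> [0, 1]\<close> is \<open>f\<close>.\<close>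

lemma sum_diff_le_by_rounding:
  fixes f :: "'a \<Rightarrow> real"
  assumes fin: "finite X" "finite Y"
    and le: "\<And>t. (\<Sum>v\<in>Y. real_of_int \<lfloor>f v + t\<rfloor>) - (\<Sum>u\<in>X. real_of_int \<lfloor>f u + t\<rfloor>) \<le> K"
  shows "sum f Y - sum f X \<le> K"
proof -
  have "((\<lambda>t. (\<Sum>v\<in>Y. real_of_int \<lfloor>f v + t\<rfloor>) - (\<Sum>u\<in>X. real_of_int \<lfloor>f u + t\<rfloor>))
      has_integral (sum f Y - sum f X)) {0..1}"
    by (intro has_integral_diff has_integral_sum fin has_integral_floor_add)
  moreover have "((\<lambda>t. K) has_integral K) {0..1::real}"
    using has_integral_const_real[of K 0 1] by simp
  ultimately show ?thesis
    by (rule has_integral_le) (rule le)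
qed

context amply_nhds
begin

text \<open>On an edge of largest increment \<open>M\<close>, subtracting the eigenvalue equations
  gives \<open>l * M\<close> as \<open>(d + 1) * M\<close> minus the difference of the punctured
  neighbourhood sums. The summand 1 comes from the edge itself.\<close>

lemma eigenvalue_ge_curvature:
  fixes f :: "'a \<Rightarrow> real"
  assumes eigen: "\<And>x. x \<in> V \<Longrightarrow> lap f x = l * f x"
    and nonconst: "a \<in> V" "b \<in> N a" "f a \<noteq> f b"
    and "\<beta> \<ge> 2"
  shows "l \<ge> 2 + real_of_int \<lceil>(real \<beta> - real \<alpha>) * real \<alpha> / (real \<beta> - 1)\<rceil>"
proof -
  define E where "E = (\<lambda>(u, v). f v - f u) ` (SIGMA u:V. N u)"
  define M where "M = Max E"
  define c where "c = \<lceil>(real \<beta> - real \<alpha>) * real \<alpha> / (real \<beta> - 1)\<rceil>"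
  have ab: "b \<in> V" "a \<in> N b"
    using nonconst nhd_in_V nhd_sym by blast+
  have fin: "finite E"
    unfolding E_def by (intro finite_imageI finite_SigmaI finite_V finite_nhd)
  have edge: "f v - f u \<in> E" if "u \<in> V" "v \<in> N u" for u v
    using that unfolding E_def by force
  have M_ge: "f v - f u \<le> M" if "u \<in> V" "v \<in> N u" for u v
    unfolding M_def using fin edge that by (intro Max_ge) auto
  \<comment> \<open>Reversing an edge negates its increment, so one nonzero increment yields a
    positive one.\<close>
  have "M > 0"
    using M_ge[OF nonconst(1,2)] M_ge[OF ab] nonconst(3) by linarith
  have "M \<in> E"
    unfolding M_def using fin edge[OF nonconst(1,2)] by (intro Max_in) auto
  then obtain x y where x: "x \<in> V" and y: "y \<in> N x" and M: "f y - f x = M"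
    by (auto simp: E_def)
  have yV: "y \<in> V" and x': "x \<in> N y"
    using x y nhd_in_V nhd_sym by blast+
  define g where "g u = f u / M" for u
  have "sum g (N y - {x}) - sum g (N x - {y}) \<le> real d - 1 - c"
  proof (rule sum_diff_le_by_rounding)
    fix t :: real
    define h where "h u = \<lfloor>g u + t\<rfloor>" for u
    define s where "s = (\<Sum>v\<in>N y - {x}. h v) - (\<Sum>u\<in>N x - {y}. h u)"
    have "real_of_int (h v) - real_of_int (h u) \<le> 1" if "u \<in> V" "v \<in> N u" for u v
    proof -
      have "g v - g u \<le> 1"
        using M_ge[OF that] \<open>M > 0\<close> by (simp add: g_def flip: diff_divide_distrib)
      \<comment> \<open>Rounding preserves increments at most 1, because the floor commutes with
        adding 1.\<close>
      then have "h v \<le> \<lfloor>(g u + t) + 1\<rfloor>"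
        unfolding h_def by (intro floor_mono) simp
      then show ?thesis
        by (simp add: h_def)
    qed
    from transport_bound[OF x y this]
    have "(real \<beta> - 1) * s \<le> (real \<beta> - 1) * (real d - 1) - real \<alpha> * (real \<beta> - real \<alpha>)"
      by (simp add: s_def)
    then have "(real \<beta> - real \<alpha>) * real \<alpha> \<le> real_of_int (int d - 1 - s) * (real \<beta> - 1)"
      by (simp add: algebra_simps)
    then have "(real \<beta> - real \<alpha>) * real \<alpha> / (real \<beta> - 1) \<le> real_of_int (int d - 1 - s)"
      using \<open>\<beta> \<ge> 2\<close> by (subst pos_divide_le_eq) auto
    \<comment> \<open>Since \<open>s\<close> is an integer, the rational bound improves to its
      ceiling.\<close>
    then have "c \<le> int d - 1 - s"
      unfolding c_def by (rule ceiling_le)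
    then have "real_of_int s \<le> real d - 1 - c"
      by linarith
    then show "(\<Sum>v\<in>N y - {x}. real_of_int \<lfloor>g v + t\<rfloor>) - (\<Sum>u\<in>N x - {y}. real_of_int \<lfloor>g u + t\<rfloor>)
        \<le> real d - 1 - c"
      by (simp add: s_def h_def)
  qed (use finite_nhd x yV in auto)
  moreover have "sum g S = sum f S / M" for S
    by (simp add: g_def sum_divide_distrib)
  ultimately have S: "sum f (N y - {x}) - sum f (N x - {y}) \<le> (real d - 1 - c) * M"
    using \<open>M > 0\<close> by (simp add: pos_divide_le_eq flip: diff_divide_distrib)
  have "lap f y = real d * f y - f x - sum f (N y - {x})"
    using sum.remove[OF finite_nhd[OF yV] x', of f] card_nhd[OF yV]
    by (simp add: lap_def sum_subtractf)
  moreover have "lap f x = real d * f x - f y - sum f (N x - {y})"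
    using sum.remove[OF finite_nhd[OF x] y, of f] card_nhd[OF x]
    by (simp add: lap_def sum_subtractf)
  ultimately have "l * M = (real d + 1) * M - (sum f (N y - {x}) - sum f (N x - {y}))"
    using eigen[OF x] eigen[OF yV] by (simp add: algebra_simps flip: M)
  then have "(2 + real_of_int c) * M \<le> l * M"
    using S by (simp add: algebra_simps)
  then show ?thesis
    using \<open>M > 0\<close> by (simp add: c_def)
qed

end

section \<open>The integrated Bakry--Emery inequality\<close>

text \<open>Variance identity about a free centre \<open>c\<close>; it is used with \<open>c\<close>
  the value at a midpoint, the value at an end point, and the mean of two end values.\<close>

lemma sum_sum_diff_square:
  fixes f :: "'a \<Rightarrow> real"
  shows "(\<Sum>a\<in>S. \<Sum>b\<in>S. (f a - f b)\<^sup>2)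
     = 2 * real (card S) * (\<Sum>a\<in>S. (f a - c)\<^sup>2) - 2 * (\<Sum>a\<in>S. f a - c)\<^sup>2"
proof -
  have "(\<Sum>a\<in>S. \<Sum>b\<in>S. (f a - f b)\<^sup>2)
      = (\<Sum>a\<in>S. \<Sum>b\<in>S. (f a - c)\<^sup>2 + (f b - c)\<^sup>2 - 2 * ((f a - c) * (f b - c)))"
    by (intro sum.cong refl) (simp add: power2_eq_square algebra_simps)
  also have "\<dots> = (\<Sum>a\<in>S. \<Sum>b\<in>S. (f a - c)\<^sup>2) + (\<Sum>a\<in>S. \<Sum>b\<in>S. (f b - c)\<^sup>2)
      - 2 * (\<Sum>a\<in>S. \<Sum>b\<in>S. (f a - c) * (f b - c))"
    by (simp only: sum.distrib sum_subtractf sum_distrib_left)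
  also have "(\<Sum>a\<in>S. \<Sum>b\<in>S. (f a - c) * (f b - c)) = (\<Sum>a\<in>S. f a - c)\<^sup>2"
    by (simp only: power2_eq_square sum_product)
  finally show ?thesis
    by (simp flip: sum_distrib_left)
qed

lemma sum_sum_second_difference_square:
  fixes f :: "'a \<Rightarrow> real"
  shows "(\<Sum>a\<in>S. \<Sum>b\<in>S. (f a + f b - 2 * c)\<^sup>2)
     = 2 * real (card S) * (\<Sum>a\<in>S. (f a - c)\<^sup>2) + 2 * (\<Sum>a\<in>S. f a - c)\<^sup>2"
proof -
  have "(\<Sum>a\<in>S. \<Sum>b\<in>S. (f a + f b - 2 * c)\<^sup>2)
      = (\<Sum>a\<in>S. \<Sum>b\<in>S. (f a - c)\<^sup>2 + (f b - c)\<^sup>2 + 2 * ((f a - c) * (f b - c)))"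
    by (intro sum.cong refl) (simp add: power2_eq_square algebra_simps)
  also have "\<dots> = (\<Sum>a\<in>S. \<Sum>b\<in>S. (f a - c)\<^sup>2) + (\<Sum>a\<in>S. \<Sum>b\<in>S. (f b - c)\<^sup>2)
      + 2 * (\<Sum>a\<in>S. \<Sum>b\<in>S. (f a - c) * (f b - c))"
    by (simp only: sum.distrib sum_distrib_left)
  also have "(\<Sum>a\<in>S. \<Sum>b\<in>S. (f a - c) * (f b - c)) = (\<Sum>a\<in>S. f a - c)\<^sup>2"
    by (simp only: power2_eq_square sum_product)
  finally show ?thesis
    by (simp flip: sum_distrib_left)
qed

section \<open>Paths of length two and quadrilaterals in regular graphs\<close>

context regular_nhds
begin

lemma dirichlet_eq': "(\<Sum>x\<in>V. \<Sum>y\<in>N x. (f y - f x)\<^sup>2) = dirichlet f"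
  by (simp add: dirichlet_def power2_commute)

lemma sum_nhd_eq_lap: "(\<Sum>y\<in>N x. f y - f x) = - lap f x"
  by (simp add: lap_def flip: sum_negf)

text \<open>Paths \<open>x - y - z\<close> are listed by midpoint on the left and by end points on
  the right. The case \<open>x = z\<close> is included and later supplies the diagonal
  terms.\<close>

lemma sum_paths:
  fixes h :: "'a \<Rightarrow> 'a \<Rightarrow> 'a \<Rightarrow> real"
  shows "(\<Sum>y\<in>V. \<Sum>x\<in>N y. \<Sum>z\<in>N y. h x y z) = (\<Sum>x\<in>V. \<Sum>z\<in>V. \<Sum>y\<in>N x \<inter> N z. h x y z)"
proof -
  have "(\<Sum>y\<in>V. \<Sum>x\<in>N y. \<Sum>z\<in>N y. h x y z) = (\<Sum>x\<in>V. \<Sum>y\<in>N x. \<Sum>z\<in>N y. h x y z)"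
    by (rule sum_nhd_swap)
  also have "\<dots> = (\<Sum>x\<in>V. \<Sum>z\<in>V. \<Sum>y\<in>N x \<inter> N z. h x y z)"
  proof (rule sum.cong)
    fix x assume x: "x \<in> V"
    have "(\<Sum>y\<in>N x. \<Sum>z\<in>N y. h x y z) = (\<Sum>y\<in>N x. \<Sum>z\<in>{z \<in> V. y \<in> N z}. h x y z)"
    proof (rule sum.cong)
      fix y assume "y \<in> N x"
      then have "N y = {z \<in> V. y \<in> N z}"
        using x nhd_in_V nhd_sym by blast
      then show "(\<Sum>z\<in>N y. h x y z) = (\<Sum>z\<in>{z \<in> V. y \<in> N z}. h x y z)"
        by simp
    qed simp
    also have "\<dots> = (\<Sum>z\<in>V. \<Sum>y\<in>{y \<in> N x. y \<in> N z}. h x y z)"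
      by (rule sum.swap_restrict[OF finite_nhd[OF x] finite_V])
    finally show "(\<Sum>y\<in>N x. \<Sum>z\<in>N y. h x y z) = (\<Sum>z\<in>V. \<Sum>y\<in>N x \<inter> N z. h x y z)"
      by (simp add: Int_def)
  qed simp
  finally show ?thesis .
qed

lemma sum_split_adjacency:
  fixes h :: "'a \<Rightarrow> real"
  assumes x: "x \<in> V"
  shows "(\<Sum>z\<in>V. h z) = h x + (\<Sum>z\<in>N x. h z) + (\<Sum>z\<in>V - insert x (N x). h z)"
proof -
  have "(\<Sum>z\<in>V. h z) = (\<Sum>z\<in>insert x (N x). h z) + (\<Sum>z\<in>V - insert x (N x). h z)"
    using sum.subset_diff[of "insert x (N x)" V h] x nhd_subset finite_V by (simp add: add.commute)
  then show ?thesis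
    using finite_nhd[OF x] nhd_irrefl by simp
qed

text \<open>Centring at the midpoint value \<open>f y\<close> turns the linear sum over
  \<open>N y\<close> into \<open>- lap f y\<close>.\<close>

lemma sum_cherries_diff:
  "(\<Sum>y\<in>V. \<Sum>x\<in>N y. \<Sum>z\<in>N y. (f x - f z)\<^sup>2)
     = 2 * real d * dirichlet f - 2 * (\<Sum>x\<in>V. (lap f x)\<^sup>2)"
proof -
  have "(\<Sum>y\<in>V. \<Sum>x\<in>N y. \<Sum>z\<in>N y. (f x - f z)\<^sup>2)
      = (\<Sum>y\<in>V. 2 * real d * (\<Sum>x\<in>N y. (f x - f y)\<^sup>2) - 2 * (lap f y)\<^sup>2)"
  proof (rule sum.cong)
    fix y assume "y \<in> V"
    then show "(\<Sum>x\<in>N y. \<Sum>z\<in>N y. (f x - f z)\<^sup>2)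
        = 2 * real d * (\<Sum>x\<in>N y. (f x - f y)\<^sup>2) - 2 * (lap f y)\<^sup>2"
      using sum_sum_diff_square[of f "N y" "f y"] by (simp add: card_nhd sum_nhd_eq_lap)
  qed simp
  then show ?thesis
    by (simp add: sum_subtractf dirichlet_eq' flip: sum_distrib_left)
qed

lemma sum_cherries_second_difference:
  "(\<Sum>y\<in>V. \<Sum>x\<in>N y. \<Sum>z\<in>N y. (f x + f z - 2 * f y)\<^sup>2)
     = 2 * real d * dirichlet f + 2 * (\<Sum>x\<in>V. (lap f x)\<^sup>2)"
proof -
  have "(\<Sum>y\<in>V. \<Sum>x\<in>N y. \<Sum>z\<in>N y. (f x + f z - 2 * f y)\<^sup>2)
      = (\<Sum>y\<in>V. 2 * real d * (\<Sum>x\<in>N y. (f x - f y)\<^sup>2) + 2 * (lap f y)\<^sup>2)"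
  proof (rule sum.cong)
    fix y assume "y \<in> V"
    then show "(\<Sum>x\<in>N y. \<Sum>z\<in>N y. (f x + f z - 2 * f y)\<^sup>2)
        = 2 * real d * (\<Sum>x\<in>N y. (f x - f y)\<^sup>2) + 2 * (lap f y)\<^sup>2"
      using sum_sum_second_difference_square[of f "f y" "N y"] by (simp add: card_nhd sum_nhd_eq_lap)
  qed simp
  then show ?thesis
    by (simp add: sum.distrib dirichlet_eq' flip: sum_distrib_left)
qed

text \<open>Exchange the two diagonals of the closed walk \<open>x - y - z - y'\<close>: for fixed
  \<open>y\<close> and \<open>y'\<close>, the vertices \<open>x\<close> and \<open>z\<close> range
  independently over their common neighbours, whence the square.\<close>

lemma sum_quadrilaterals:
  fixes h :: "'a \<Rightarrow> 'a \<Rightarrow> real"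
  shows "(\<Sum>x\<in>V. \<Sum>z\<in>V. \<Sum>y\<in>N x \<inter> N z. \<Sum>y'\<in>N x \<inter> N z. h y y')
     = (\<Sum>y\<in>V. \<Sum>y'\<in>V. (real (card (N y \<inter> N y')))\<^sup>2 * h y y')"
proof -
  have "(\<Sum>x\<in>V. \<Sum>z\<in>V. \<Sum>y\<in>N x \<inter> N z. \<Sum>y'\<in>N x \<inter> N z. h y y')
      = (\<Sum>y\<in>V. \<Sum>x\<in>N y. \<Sum>z\<in>N y. \<Sum>y'\<in>N x \<inter> N z. h y y')"
    by (rule sum_paths[symmetric])
  also have "\<dots> = (\<Sum>y\<in>V. \<Sum>y'\<in>V. (real (card (N y \<inter> N y')))\<^sup>2 * h y y')"
  proof (rule sum.cong)
    fix y assume y: "y \<in> V"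
    have fin: "finite (N y)"
      using y by (rule finite_nhd)
    have "(\<Sum>x\<in>N y. \<Sum>z\<in>N y. \<Sum>y'\<in>N x \<inter> N z. h y y')
        = (\<Sum>p\<in>N y \<times> N y. \<Sum>y'\<in>{y' \<in> V. y' \<in> N (fst p) \<inter> N (snd p)}. h y y')"
      unfolding sum.cartesian_product case_prod_beta
    proof (rule sum.cong)
      fix p assume "p \<in> N y \<times> N y"
      then have "N (fst p) \<inter> N (snd p) = {y' \<in> V. y' \<in> N (fst p) \<inter> N (snd p)}"
        using y nhd_in_V by (auto dest: nhd_in_V[OF nhd_in_V[OF y]])
      then show "(\<Sum>y'\<in>N (fst p) \<inter> N (snd p). h y y')
          = (\<Sum>y'\<in>{y' \<in> V. y' \<in> N (fst p) \<inter> N (snd p)}. h y y')"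
        by simp
    qed simp
    also have "\<dots> = (\<Sum>y'\<in>V. \<Sum>p\<in>{p \<in> N y \<times> N y. y' \<in> N (fst p) \<inter> N (snd p)}. h y y')"
      by (rule sum.swap_restrict) (use fin finite_V in auto)
    also have "\<dots> = (\<Sum>y'\<in>V. (real (card (N y \<inter> N y')))\<^sup>2 * h y y')"
    proof (rule sum.cong)
      fix y' assume "y' \<in> V"
      then have "{p \<in> N y \<times> N y. y' \<in> N (fst p) \<inter> N (snd p)} = (N y \<inter> N y') \<times> (N y \<inter> N y')"
        using nhd_sym nhd_in_V[OF y] by auto
      then show "(\<Sum>p\<in>{p \<in> N y \<times> N y. y' \<in> N (fst p) \<inter> N (snd p)}. h y y')
          = (real (card (N y \<inter> N y')))\<^sup>2 * h y y'"
        by (simp add: power2_eq_square card_cartesian_product)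
    qed simp
    finally show "(\<Sum>x\<in>N y. \<Sum>z\<in>N y. \<Sum>y'\<in>N x \<inter> N z. h y y')
        = (\<Sum>y'\<in>V. (real (card (N y \<inter> N y')))\<^sup>2 * h y y')" .
  qed simp
  finally show ?thesis .
qed

end

section \<open>Triangles and second differences in amply regular graphs\<close>

context amply_nhds
begin

text \<open>Every edge lies in \<alpha> triangles, so it does not matter to which side of the
  triangle \<open>h\<close> is attached.\<close>

lemma sum_triangles:
  fixes h :: "'a \<Rightarrow> 'a \<Rightarrow> real"
  defines "e \<equiv> \<Sum>x\<in>V. \<Sum>y\<in>N x. h x y"
  shows "(\<Sum>x\<in>V. \<Sum>z\<in>N x. \<Sum>y\<in>N x \<inter> N z. h x z) = real \<alpha> * e"
    and "(\<Sum>x\<in>V. \<Sum>z\<in>N x. \<Sum>y\<in>N x \<inter> N z. h x y) = real \<alpha> * e"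
    and "(\<Sum>x\<in>V. \<Sum>z\<in>N x. \<Sum>y\<in>N x \<inter> N z. h z y) = real \<alpha> * e"
proof -
  show "(\<Sum>x\<in>V. \<Sum>z\<in>N x. \<Sum>y\<in>N x \<inter> N z. h x z) = real \<alpha> * e"
    unfolding e_def sum_distrib_left by (intro sum.cong refl) (simp add: card_common_adj)
  have 2: "(\<Sum>z\<in>N x. \<Sum>y\<in>N x \<inter> N z. h x y) = real \<alpha> * (\<Sum>y\<in>N x. h x y)" if x: "x \<in> V" for x
  proof -
    have "(\<Sum>z\<in>N x. \<Sum>y\<in>N x \<inter> N z. h x y) = (\<Sum>z\<in>N x. \<Sum>y\<in>{y \<in> N x. y \<in> N z}. h x y)"
      by (simp add: Int_def)
    also have "\<dots> = (\<Sum>y\<in>N x. \<Sum>z\<in>{z \<in> N x. y \<in> N z}. h x y)"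
      using finite_nhd[OF x] by (intro sum.swap_restrict)
    also have "\<dots> = (\<Sum>y\<in>N x. real \<alpha> * h x y)"
    proof (rule sum.cong)
      fix y assume y: "y \<in> N x"
      then have "{z \<in> N x. y \<in> N z} = N x \<inter> N y"
        using nhd_sym nhd_in_V[OF x] by blast
      then show "(\<Sum>z\<in>{z \<in> N x. y \<in> N z}. h x y) = real \<alpha> * h x y"
        using card_common_adj x y by simp
    qed simp
    finally show ?thesis
      by (simp add: sum_distrib_left)
  qed
  then show *: "(\<Sum>x\<in>V. \<Sum>z\<in>N x. \<Sum>y\<in>N x \<inter> N z. h x y) = real \<alpha> * e"
    by (simp add: e_def sum_distrib_left)
  have "(\<Sum>x\<in>V. \<Sum>z\<in>N x. \<Sum>y\<in>N x \<inter> N z. h z y) = (\<Sum>x\<in>V. \<Sum>z\<in>N x. \<Sum>y\<in>N z \<inter> N x. h x y)"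
    by (rule sum_nhd_swap)
  then show "(\<Sum>x\<in>V. \<Sum>z\<in>N x. \<Sum>y\<in>N x \<inter> N z. h z y) = real \<alpha> * e"
    using * by (simp add: Int_commute)
qed

text \<open>
  Completing the square with the weight \<open>\<alpha> / 2\<close> is what produces the constant
  \<open>2 + \<alpha> / 2\<close> of the Bakry--Emery bound.
\<close>

lemma sum_triangles_diff_le:
  "(\<Sum>x\<in>V. \<Sum>z\<in>N x. \<Sum>y\<in>N x \<inter> N z. \<Sum>y'\<in>N x \<inter> N z. (f y - f y')\<^sup>2)
     \<le> 3 / 2 * (real \<alpha>)\<^sup>2 * dirichlet f"
proof -
  define D where "D = dirichlet f"
  define s where "s x z = (\<Sum>y\<in>N x \<inter> N z. f y - f x)" for x z
  define S where "S = (\<Sum>x\<in>V. \<Sum>z\<in>N x. (s x z)\<^sup>2)"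
  have "(\<Sum>x\<in>V. \<Sum>z\<in>N x. \<Sum>y\<in>N x \<inter> N z. \<Sum>y'\<in>N x \<inter> N z. (f y - f y')\<^sup>2)
      = (\<Sum>x\<in>V. \<Sum>z\<in>N x. 2 * real \<alpha> * (\<Sum>y\<in>N x \<inter> N z. (f y - f x)\<^sup>2) - 2 * (s x z)\<^sup>2)"
  proof (intro sum.cong refl)
    fix x z assume "x \<in> V" "z \<in> N x"
    then show "(\<Sum>y\<in>N x \<inter> N z. \<Sum>y'\<in>N x \<inter> N z. (f y - f y')\<^sup>2)
        = 2 * real \<alpha> * (\<Sum>y\<in>N x \<inter> N z. (f y - f x)\<^sup>2) - 2 * (s x z)\<^sup>2"
      using sum_sum_diff_square[of f "N x \<inter> N z" "f x"] by (simp add: card_common_adj s_def)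
  qed
  also have "\<dots> = 2 * real \<alpha> * (real \<alpha> * D) - 2 * S"
    using sum_triangles(2)[of "\<lambda>x y. (f y - f x)\<^sup>2"]
    by (simp add: sum_subtractf S_def D_def dirichlet_eq' flip: sum_distrib_left)
  finally have eq: "(\<Sum>x\<in>V. \<Sum>z\<in>N x. \<Sum>y\<in>N x \<inter> N z. \<Sum>y'\<in>N x \<inter> N z. (f y - f y')\<^sup>2)
      = 2 * (real \<alpha>)\<^sup>2 * D - 2 * S"
    by (simp add: power2_eq_square)
  \<comment> \<open>Polarisation: the product of two increments at \<open>x\<close> becomes a
    combination of the squared increments on the three sides, each summing to
    \<open>\<alpha> * D\<close>.\<close>
  have "(\<Sum>x\<in>V. \<Sum>z\<in>N x. s x z * (f z - f x))
      = (\<Sum>x\<in>V. \<Sum>z\<in>N x. \<Sum>y\<in>N x \<inter> N z. ((f x - f y)\<^sup>2 + (f x - f z)\<^sup>2 - (f z - f y)\<^sup>2) / 2)"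
    unfolding s_def sum_distrib_right
    by (intro sum.cong refl) (simp add: power2_eq_square algebra_simps)
  also have "\<dots> = (real \<alpha> * D + real \<alpha> * D - real \<alpha> * D) / 2"
    using sum_triangles[of "\<lambda>x y. (f x - f y)\<^sup>2"]
    by (simp add: sum.distrib sum_subtractf D_def dirichlet_def flip: sum_divide_distrib)
  finally have cross: "(\<Sum>x\<in>V. \<Sum>z\<in>N x. s x z * (f z - f x)) = real \<alpha> * D / 2"
    by simp
  \<comment> \<open>This yields \<open>S\<close> at least a quarter of \<alpha> squared times
    \<open>D\<close>, which lowers the factor 2 in \<open>eq\<close> to 3/2.\<close>
  have "0 \<le> (\<Sum>x\<in>V. \<Sum>z\<in>N x. (s x z - real \<alpha> / 2 * (f z - f x))\<^sup>2)"
    by (intro sum_nonneg) simp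
  also have "\<dots> = (\<Sum>x\<in>V. \<Sum>z\<in>N x. (s x z)\<^sup>2 - real \<alpha> * (s x z * (f z - f x))
      + (real \<alpha>)\<^sup>2 / 4 * (f z - f x)\<^sup>2)"
    by (intro sum.cong refl) (simp add: power2_eq_square field_simps)
  also have "\<dots> = S - real \<alpha> * (\<Sum>x\<in>V. \<Sum>z\<in>N x. s x z * (f z - f x)) + (real \<alpha>)\<^sup>2 / 4 * D"
    by (simp only: sum.distrib sum_subtractf S_def D_def dirichlet_eq' flip: sum_distrib_left)
  also have "\<dots> = S - (real \<alpha>)\<^sup>2 * D / 4"
    unfolding cross by (simp add: power2_eq_square field_simps)
  finally show ?thesis
    unfolding eq by (simp add: D_def mult.commute)
qed

text \<open>Apply the variance identity with the mean of \<open>f x\<close> and \<open>f z\<close>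
  as centre and drop the negative square; each second difference is -2 times the deviation of
  \<open>f y\<close> from that mean.\<close>

lemma sum_squares_dist2_le:
  assumes x: "x \<in> V" and z: "z \<in> V - insert x (N x)"
  shows "2 * (\<Sum>y\<in>N x \<inter> N z. \<Sum>y'\<in>N x \<inter> N z. (f y - f y')\<^sup>2)
     \<le> real \<beta> * (\<Sum>y\<in>N x \<inter> N z. (f x + f z - 2 * f y)\<^sup>2)"
proof (cases "N x \<inter> N z = {}")
  case False
  define c where "c = (f x + f z) / 2"
  have "card (N x \<inter> N z) = \<beta>"
    using card_common_dist2 x z False by auto
  then have "(\<Sum>y\<in>N x \<inter> N z. \<Sum>y'\<in>N x \<inter> N z. (f y - f y')\<^sup>2)
      \<le> 2 * real \<beta> * (\<Sum>y\<in>N x \<inter> N z. (f y - c)\<^sup>2)"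
    using sum_sum_diff_square[of f "N x \<inter> N z" c] by simp
  moreover have "(\<Sum>y\<in>N x \<inter> N z. (f x + f z - 2 * f y)\<^sup>2) = 4 * (\<Sum>y\<in>N x \<inter> N z. (f y - c)\<^sup>2)"
    unfolding sum_distrib_left
    by (intro sum.cong refl) (simp add: c_def power2_eq_square field_simps)
  ultimately show ?thesis
    by simp
qed simp

text \<open>The total over all pairs \<open>x, z\<close> is computed exactly by exchanging
  diagonals. Removing the pairs \<open>x = z\<close>, and the adjacent pairs by
  \<open>sum_triangles_diff_le\<close>, leaves those at distance at least two.\<close>

lemma sum_dist2_quadrilaterals_ge:
  "(\<Sum>x\<in>V. \<Sum>z\<in>V - insert x (N x). \<Sum>y\<in>N x \<inter> N z. \<Sum>y'\<in>N x \<inter> N z. (f y - f y')\<^sup>2)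
     \<ge> (real \<beta> - 1) * (2 * real d * dirichlet f - 2 * (\<Sum>x\<in>V. (lap f x)\<^sup>2))
        + (real \<alpha> * (real \<alpha> - real \<beta>) - 3 / 2 * (real \<alpha>)\<^sup>2) * dirichlet f"
proof -
  define D where "D = dirichlet f"
  define P where "P = 2 * real d * D - 2 * (\<Sum>x\<in>V. (lap f x)\<^sup>2)"
  define q where "q x z = (\<Sum>y\<in>N x \<inter> N z. \<Sum>y'\<in>N x \<inter> N z. (f y - f y')\<^sup>2)" for x z
  have "(\<Sum>x\<in>V. \<Sum>z\<in>V. q x z)
      = (\<Sum>y\<in>V. \<Sum>y'\<in>V. (real (card (N y \<inter> N y')))\<^sup>2 * (f y - f y')\<^sup>2)"
    unfolding q_def by (rule sum_quadrilaterals)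
  \<comment> \<open>The number of common neighbours is 0 or \<beta> for distinct non-adjacent
    vertices, so its square is \<beta> times itself; adjacent pairs require the correction
    \<open>\<alpha> * (\<alpha> - \<beta>)\<close>, and \<open>y = y'\<close> contributes
    zero.\<close>
  also have "\<dots> = (\<Sum>y\<in>V. \<Sum>y'\<in>V. real \<beta> * (\<Sum>x\<in>N y \<inter> N y'. (f y - f y')\<^sup>2)
      + real \<alpha> * (real \<alpha> - real \<beta>) * (if y' \<in> N y then (f y - f y')\<^sup>2 else 0))"
  proof (intro sum.cong refl)
    fix y y' assume V: "y \<in> V" "y' \<in> V"
    consider "y = y'" | "y' \<in> N y" | "y \<noteq> y'" "y' \<notin> N y" "N y \<inter> N y' = {}"
      | "y \<noteq> y'" "y' \<notin> N y" "N y \<inter> N y' \<noteq> {}"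
      by blast
    then show "(real (card (N y \<inter> N y')))\<^sup>2 * (f y - f y')\<^sup>2
      = real \<beta> * (\<Sum>x\<in>N y \<inter> N y'. (f y - f y')\<^sup>2)
        + real \<alpha> * (real \<alpha> - real \<beta>) * (if y' \<in> N y then (f y - f y')\<^sup>2 else 0)"
    proof cases
      case 2
      then show ?thesis
        using V by (simp add: card_common_adj power2_eq_square algebra_simps)
    next
      case 4
      then show ?thesis
        using V by (simp add: card_common_dist2 power2_eq_square)
    qed simp_all
  qed
  also have "\<dots> = real \<beta> * (\<Sum>y\<in>V. \<Sum>y'\<in>V. \<Sum>x\<in>N y \<inter> N y'. (f y - f y')\<^sup>2)
      + real \<alpha> * (real \<alpha> - real \<beta>) * (\<Sum>y\<in>V. \<Sum>y'\<in>V. if y' \<in> N y then (f y - f y')\<^sup>2 else 0)"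
    by (simp only: sum.distrib flip: sum_distrib_left)
  also have "(\<Sum>y\<in>V. \<Sum>y'\<in>V. \<Sum>x\<in>N y \<inter> N y'. (f y - f y')\<^sup>2) = P"
    unfolding P_def D_def sum_cherries_diff[symmetric] by (rule sum_paths[symmetric])
  also have "(\<Sum>y\<in>V. \<Sum>y'\<in>V. if y' \<in> N y then (f y - f y')\<^sup>2 else 0) = D"
    unfolding D_def dirichlet_def
    by (rule sum.cong) (simp_all add: sum.inter_restrict[symmetric] finite_V Int_absorb1 nhd_subset)
  finally have all: "(\<Sum>x\<in>V. \<Sum>z\<in>V. q x z) = real \<beta> * P + real \<alpha> * (real \<alpha> - real \<beta>) * D" .
  have "(\<Sum>x\<in>V. \<Sum>z\<in>V. q x z)
      = (\<Sum>x\<in>V. q x x + (\<Sum>z\<in>N x. q x z) + (\<Sum>z\<in>V - insert x (N x). q x z))"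
    by (intro sum.cong refl sum_split_adjacency)
  also have "\<dots> = (\<Sum>x\<in>V. q x x) + (\<Sum>x\<in>V. \<Sum>z\<in>N x. q x z)
      + (\<Sum>x\<in>V. \<Sum>z\<in>V - insert x (N x). q x z)"
    by (simp only: sum.distrib)
  also have "(\<Sum>x\<in>V. q x x) = P"
    by (simp add: q_def P_def D_def flip: sum_cherries_diff)
  finally have "(\<Sum>x\<in>V. \<Sum>z\<in>V - insert x (N x). q x z)
      = (real \<beta> - 1) * P + real \<alpha> * (real \<alpha> - real \<beta>) * D - (\<Sum>x\<in>V. \<Sum>z\<in>N x. q x z)"
    using all by (simp add: algebra_simps)
  moreover have "(\<Sum>x\<in>V. \<Sum>z\<in>N x. q x z) \<le> 3 / 2 * (real \<alpha>)\<^sup>2 * D"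
    unfolding q_def D_def by (rule sum_triangles_diff_le)
  ultimately show ?thesis
    by (simp add: P_def D_def q_def algebra_simps)
qed

text \<open>Squared second differences total \<open>2 * d * D + 2 * F\<close> by midpoint. By end
  points, \<open>x = z\<close> gives \<open>4 * D\<close>, adjacent ends give
  \<open>3 * \<alpha> * D\<close>, and the rest \<open>M\<close> is bounded below through
  quadrilaterals.\<close>

lemma sum_lap_square_ge:
  "(6 * real \<beta> - 4) * (\<Sum>x\<in>V. (lap f x)\<^sup>2)
     \<ge> (4 * real \<beta> + real \<alpha> * real \<beta> + 2 * real d * (real \<beta> - 2) - (real \<alpha>)\<^sup>2) * dirichlet f"
proof -
  define D where "D = dirichlet f"
  define F where "F = (\<Sum>x\<in>V. (lap f x)\<^sup>2)"
  define m where "m x z = (\<Sum>y\<in>N x \<inter> N z. (f x + f z - 2 * f y)\<^sup>2)" for x z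
  define M where "M = (\<Sum>x\<in>V. \<Sum>z\<in>V - insert x (N x). m x z)"
  have "2 * real d * D + 2 * F = (\<Sum>x\<in>V. \<Sum>z\<in>V. m x z)"
    unfolding D_def F_def m_def sum_cherries_second_difference[symmetric] by (rule sum_paths)
  also have "\<dots> = (\<Sum>x\<in>V. m x x + (\<Sum>z\<in>N x. m x z) + (\<Sum>z\<in>V - insert x (N x). m x z))"
    by (intro sum.cong refl sum_split_adjacency)
  also have "\<dots> = (\<Sum>x\<in>V. m x x) + (\<Sum>x\<in>V. \<Sum>z\<in>N x. m x z) + M"
    by (simp only: sum.distrib M_def)
  also have "(\<Sum>x\<in>V. m x x) = 4 * D"
    unfolding D_def dirichlet_def m_def sum_distrib_left
    by (intro sum.cong refl) (auto simp: power2_eq_square algebra_simps)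
  \<comment> \<open>Parallelogram law for the increments from \<open>y\<close> to \<open>x\<close>
    and to \<open>z\<close>.\<close>
  also have "(\<Sum>x\<in>V. \<Sum>z\<in>N x. m x z) = (\<Sum>x\<in>V. \<Sum>z\<in>N x. \<Sum>y\<in>N x \<inter> N z.
      2 * (f x - f y)\<^sup>2 + 2 * (f z - f y)\<^sup>2 - (f x - f z)\<^sup>2)"
    unfolding m_def by (intro sum.cong refl) (simp add: power2_eq_square algebra_simps)
  also have "\<dots> = 2 * (real \<alpha> * D) + 2 * (real \<alpha> * D) - real \<alpha> * D"
    using sum_triangles[of "\<lambda>x y. (f x - f y)\<^sup>2"]
    by (simp add: sum.distrib sum_subtractf D_def dirichlet_def flip: sum_distrib_left)
  finally have total: "2 * real d * D + 2 * F = 4 * D + 3 * real \<alpha> * D + M"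
    by simp
  define Q where "Q = (\<Sum>x\<in>V. \<Sum>z\<in>V - insert x (N x). \<Sum>y\<in>N x \<inter> N z. \<Sum>y'\<in>N x \<inter> N z. (f y - f y')\<^sup>2)"
  have "2 * ((real \<beta> - 1) * (2 * real d * D - 2 * F)
      + (real \<alpha> * (real \<alpha> - real \<beta>) - 3 / 2 * (real \<alpha>)\<^sup>2) * D) \<le> 2 * Q"
    using sum_dist2_quadrilaterals_ge[of f, folded D_def F_def Q_def] by (rule mult_left_mono) simp
  also have "2 * Q \<le> real \<beta> * M"
    unfolding Q_def M_def m_def sum_distrib_left[of _ _ V] sum_distrib_left[of _ _ "V - _"]
    by (intro sum_mono sum_squares_dist2_le)
  also have "real \<beta> * M = real \<beta> * (2 * real d * D + 2 * F - 4 * D - 3 * real \<alpha> * D)"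
    using total by simp
  finally show ?thesis
    unfolding F_def[symmetric] D_def[symmetric] by (simp add: power2_eq_square algebra_simps)
qed

end

section \<open>Amply regular graphs\<close>

context amply_nhds
begin

text \<open>
  For \<open>\<beta> \<ge> 2 * \<alpha> - 1\<close> the ceiling is at least \<open>\<alpha> / 2\<close>, so the second bound is needed
  only for \<open>\<beta> < 2 * \<alpha> - 1\<close>, which forces \<open>\<alpha> \<ge> 3\<close>.
\<close>

lemma eigenvalue_ge_max:
  fixes f :: "'a \<Rightarrow> real"
  defines "c \<equiv> real_of_int \<lceil>(real \<beta> - real \<alpha>) * real \<alpha> / (real \<beta> - 1)\<rceil>"
  assumes eigen: "\<And>x. x \<in> V \<Longrightarrow> lap f x = l * f x"
    and nonconst: "a \<in> V" "b \<in> N a" "f a \<noteq> f b"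
    and "\<beta> \<noteq> 1" "\<alpha> < \<beta>" "\<beta> \<le> d"
  shows "4 + max (real \<alpha>) (2 * c) \<le> 2 * l"
proof -
  have "\<beta> \<ge> 2"
    using assms by linarith
  then have curv: "2 + c \<le> l"
    unfolding c_def using eigenvalue_ge_curvature[OF eigen nonconst] by simp
  have "4 + real \<alpha> \<le> 2 * l"
  proof (cases "real \<alpha> \<le> 2 * c")
    case True
    then show ?thesis
      using curv by linarith
  next
    case False
    have "(real \<beta> - real \<alpha>) * real \<alpha> / (real \<beta> - 1) \<le> c"
      unfolding c_def by (rule le_of_int_ceiling)
    then have "(real \<beta> - real \<alpha>) * real \<alpha> / (real \<beta> - 1) < real \<alpha> / 2"
      using False by linarith
    then have "(2 * (real \<beta> - real \<alpha>)) * real \<alpha> < (real \<beta> - 1) * real \<alpha>"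
      using \<open>\<beta> \<ge> 2\<close> by (simp add: field_simps)
    then have "2 * (real \<beta> - real \<alpha>) < real \<beta> - 1"
      by (rule mult_right_less_imp_less) simp
    then have "real (\<beta> + 1) < real (2 * \<alpha>)"
      by simp
    then have "\<alpha> \<ge> 3"
      using \<open>\<alpha> < \<beta>\<close> unfolding of_nat_less_iff by linarith
    then have \<alpha>: "real \<alpha> \<ge> 3" and \<beta>: "real \<beta> \<ge> real \<alpha> + 1" "real d \<ge> real \<alpha> + 1"
      using \<open>\<alpha> < \<beta>\<close> \<open>\<beta> \<le> d\<close> by simp_all
    define D where "D = dirichlet f"
    have "D = 2 * (\<Sum>x\<in>V. l * f x * f x)"
      by (simp add: D_def dirichlet_eq_lap eigen)
    then have D: "D = 2 * l * (\<Sum>x\<in>V. (f x)\<^sup>2)"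
      by (simp add: power2_eq_square sum_distrib_left mult.assoc)
    have "(\<Sum>x\<in>V. (lap f x)\<^sup>2) = l * D / 2"
      unfolding D by (simp add: eigen power_mult_distrib flip: sum_distrib_left) (simp add: power2_eq_square)
    then have main: "(6 * real \<beta> - 4) * (l * D / 2)
        \<ge> (4 * real \<beta> + real \<alpha> * real \<beta> + 2 * real d * (real \<beta> - 2) - (real \<alpha>)\<^sup>2) * D"
      using sum_lap_square_ge[of f] by (simp only: flip: D_def)
    have "D > 0"
    proof -
      have "0 < (f a - f b)\<^sup>2"
        using nonconst by simp
      also have "\<dots> \<le> (\<Sum>y\<in>N a. (f a - f y)\<^sup>2)"
        using nonconst finite_nhd by (intro member_le_sum) auto
      also have "\<dots> \<le> D"
        unfolding D_def dirichlet_def using nonconst(1) finite_V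
        by (intro member_le_sum[of a V "\<lambda>x. \<Sum>y\<in>N x. (f x - f y)\<^sup>2"] sum_nonneg) auto
      finally show ?thesis .
    qed
    \<comment> \<open>The difference of the two sides is
      \<open>(\<beta> - 2) * (4 * d - 4 - \<alpha>)\<close> minus twice \<alpha> squared. With
      \<beta> and \<open>d\<close> at least \<open>\<alpha> + 1\<close>, the claim reduces to
      \<open>\<alpha> \<ge> 3\<close>.\<close>
    have "(3 * real \<beta> - 2) * (4 + real \<alpha>) \<le> 2 * (4 * real \<beta> + real \<alpha> * real \<beta> + 2 * real d * (real \<beta> - 2) - (real \<alpha>)\<^sup>2)"
    proof -
      have "2 * (real \<alpha>)\<^sup>2 \<le> (real \<alpha> - 1) * (3 * real \<alpha>)"
        using mult_mono[OF \<alpha> order_refl, of "real \<alpha>"] by (simp add: power2_eq_square algebra_simps)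
      also have "\<dots> \<le> (real \<beta> - 2) * (4 * real d - 4 - real \<alpha>)"
        using \<alpha> \<beta> by (intro mult_mono) auto
      finally show ?thesis
        by (simp add: power2_eq_square algebra_simps)
    qed
    then have "(3 * real \<beta> - 2) * (4 + real \<alpha>) * D
        \<le> 2 * (4 * real \<beta> + real \<alpha> * real \<beta> + 2 * real d * (real \<beta> - 2) - (real \<alpha>)\<^sup>2) * D"
      using \<open>D > 0\<close> by (intro mult_right_mono) auto
    also have "\<dots> \<le> 2 * ((6 * real \<beta> - 4) * (l * D / 2))"
      using main by (simp only: mult.assoc mult_le_cancel_left_pos zero_less_numeral)
    also have "\<dots> = (3 * real \<beta> - 2) * (2 * l) * D"
      by (simp add: algebra_simps)
    finally have "((3 * real \<beta> - 2) * D) * (4 + real \<alpha>) \<le> ((3 * real \<beta> - 2) * D) * (2 * l)"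
      by (simp add: algebra_simps)
    then show ?thesis
      using \<open>D > 0\<close> \<open>\<beta> \<ge> 2\<close> by (subst (asm) mult_le_cancel_left_pos) auto
  qed
  then show ?thesis
    using curv by simp
qed

text \<open>The Alon--Milman bound stays valid when \<open>2 * l\<close> is replaced by its lower
  bound \<open>k\<close>, and \<open>k / (d + k)\<close> is the constant sought.\<close>

lemma card_bdry_ge:
  assumes connected: "\<And>S. S \<subseteq> V \<Longrightarrow> S \<noteq> {} \<Longrightarrow> (\<And>x. x \<in> S \<Longrightarrow> N x \<subseteq> S) \<Longrightarrow> S = V"
    and edge: "u \<in> V" "v \<in> N u"
    and params: "\<beta> \<noteq> 1" "\<alpha> < \<beta>" "\<beta> \<le> d"
    and W: "W \<subseteq> V" "2 * card W \<le> card V"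
  shows "(1 - real d / (real d + 4 + max (real \<alpha>)
            (2 * real_of_int \<lceil>(real \<beta> - real \<alpha>) * real \<alpha> / (real \<beta> - 1)\<rceil>))) * real (card W)
         \<le> real (card (bdry W))"
proof -
  define k where "k = 4 + max (real \<alpha>)
    (2 * real_of_int \<lceil>(real \<beta> - real \<alpha>) * real \<alpha> / (real \<beta> - 1)\<rceil>)"
  have "v \<in> V" "u \<noteq> v"
    using edge nhd_in_V nhd_irrefl by blast+
  then obtain f l where f: "(\<Sum>x\<in>V. f x) = 0" "(\<Sum>x\<in>V. (f x)\<^sup>2) = 1"
    and eigen: "\<And>x. x \<in> V \<Longrightarrow> lap f x = l * f x"
    and gap: "\<And>g. (\<Sum>x\<in>V. g x) = 0 \<Longrightarrow> 2 * l * (\<Sum>x\<in>V. (g x)\<^sup>2) \<le> dirichlet g"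
    using spectral_gap[OF edge(1)] by blast
  \<comment> \<open>Otherwise the level set of \<open>f\<close> through \<open>u\<close> is closed
    under adjacency, so \<open>f\<close> is constant by connectedness; sum zero then contradicts
    norm one.\<close>
  have "\<exists>a b. a \<in> V \<and> b \<in> N a \<and> f a \<noteq> f b"
  proof (rule ccontr)
    assume "\<nexists>a b. a \<in> V \<and> b \<in> N a \<and> f a \<noteq> f b"
    then have "N x \<subseteq> {x \<in> V. f x = f u}" if "x \<in> {x \<in> V. f x = f u}" for x
      using that nhd_in_V by (metis (mono_tags, lifting) mem_Collect_eq subsetI)
    then have "{x \<in> V. f x = f u} = V"
      using edge(1) by (intro connected) auto
    then have const: "f x = f u" if "x \<in> V" for x
      using that by blast
    then have "real (card V) * f u = 0"
      using f(1) by simp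
    then have "f u = 0"
      using edge(1) finite_V by auto
    then show False
      using const f(2) by simp
  qed
  then obtain a b where ab: "a \<in> V" "b \<in> N a" "f a \<noteq> f b"
    by blast
  have k: "k \<le> 2 * l" "4 \<le> k"
    unfolding k_def using eigenvalue_ge_max[OF eigen ab params] by auto
  define w n where "w = real (card W)" and "n = real (card (bdry W))"
  have "2 * l * (w - n) \<le> d * n"
    unfolding w_def n_def using k by (intro bdry_bound_of_spectral_gap gap W) auto
  \<comment> \<open>The maximum with 0 covers \<open>w < n\<close>, where replacing
    \<open>2 * l\<close> by \<open>k\<close> goes the wrong way but the left side is
    nonpositive.\<close>
  moreover have "k * (w - n) \<le> max 0 (2 * l * (w - n))"
    using k by (cases "w \<ge> n") (auto simp: le_max_iff_disj mult_right_mono mult_nonneg_nonpos)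
  moreover have "0 \<le> d * n"
    by (simp add: n_def)
  ultimately have "k * (w - n) \<le> d * n"
    by linarith
  then have "k / (d + k) * w \<le> n"
    using k by (simp add: field_simps)
  also have "k / (d + k) = 1 - d / (d + k)"
    using k by (simp add: field_simps)
  finally show ?thesis
    by (simp add: k_def w_def n_def add.assoc)
qed

end

section \<open>From digraphs to neighbourhood sets\<close>

lemma graph_dist_eq_2:
  fixes G :: "('a, 'b) pre_digraph"
  assumes "wf_digraph G" "u \<noteq> v" "\<not> u \<rightarrow>\<^bsub>G\<^esub> v" "u \<rightarrow>\<^bsub>G\<^esub> w" "w \<rightarrow>\<^bsub>G\<^esub> v"
  shows "graph_dist G u v = 2"
proof -
  interpret wf_digraph G
    by fact
  have cost: "awalk_cost (\<lambda>_. 1) p = real (length p)" for p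
    by (induction p) auto
  obtain e e' where e: "e \<in> arcs G" "tail G e = u" "head G e = w"
      "e' \<in> arcs G" "tail G e' = w" "head G e' = v"
    using assms by blast
  then have "awalk u [e, e'] v"
    by (auto simp: awalk_simps)
  then have "\<mu> (\<lambda>_. 1) u v \<le> 2"
    using min_cost_le_walk_cost[of u "[e, e']" v "\<lambda>_. 1"] by simp
  moreover have "2 \<le> \<mu> (\<lambda>_. 1) u v"
    unfolding \<mu>_def
  proof (rule INF_greatest)
    fix p assume "p \<in> {p. awalk u p v}"
    then have p: "awalk u p v"
      by simp
    have "p \<noteq> []"
      using p assms by (auto simp: awalk_simps)
    moreover have "p \<noteq> [a]" for a
      using p assms by (auto simp: awalk_simps arcs_ends_conv)
    ultimately have "length p \<ge> 2"
      by (cases p; cases "tl p") auto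
    then show "2 \<le> ereal (awalk_cost (\<lambda>_. 1) p)"
      by (simp add: cost numeral_eq_ereal)
  qed
  ultimately show ?thesis
    unfolding graph_dist_def by (rule antisym)
qed

lemma amply_nhds_of_amply_regular:
  fixes G :: "('a, 'b) pre_digraph"
  assumes G: "amply_regular n d \<alpha> \<beta> G"
  shows "amply_nhds (verts G) (\<lambda>x. {y. x \<rightarrow>\<^bsub>G\<^esub> y}) d \<alpha> \<beta>"
proof -
  interpret graph G
    using G by (simp add: amply_regular_def)
  have common: "common_nbrs G x y = {z. x \<rightarrow>\<^bsub>G\<^esub> z} \<inter> {z. y \<rightarrow>\<^bsub>G\<^esub> z}" for x y
    by (auto simp: common_nbrs_def dest: adj_in_verts)
  show ?thesis
  proof
    show "finite (verts G)"
      by simp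
    show "x \<notin> {y. x \<rightarrow>\<^bsub>G\<^esub> y}" for x
      using adj_not_same by auto
    fix x assume x: "x \<in> verts G"
    show "{y. x \<rightarrow>\<^bsub>G\<^esub> y} \<subseteq> verts G"
      by (auto dest: adj_in_verts)
    \<comment> \<open>The out-degree counts arcs; without parallel arcs it counts
      neighbours.\<close>
    have "bij_betw (head G) (out_arcs G x) {y. x \<rightarrow>\<^bsub>G\<^esub> y}"
      unfolding bij_betw_def
      by (auto simp: inj_on_def arcs_ends_conv arc_to_ends_def intro!: no_multi_arcs)
    then show "card {y. x \<rightarrow>\<^bsub>G\<^esub> y} = d"
      using G x by (auto simp: amply_regular_def out_degree_def dest: bij_betw_same_card)
    fix y
    show "x \<in> {z. y \<rightarrow>\<^bsub>G\<^esub> z}" if "y \<in> {z. x \<rightarrow>\<^bsub>G\<^esub> z}"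
      using that sym_arcs arcs_ends_symmetric by auto
    show "card ({z. x \<rightarrow>\<^bsub>G\<^esub> z} \<inter> {z. y \<rightarrow>\<^bsub>G\<^esub> z}) = \<alpha>" if "y \<in> {z. x \<rightarrow>\<^bsub>G\<^esub> z}"
      using that G x adj_in_verts unfolding amply_regular_def common by blast
    show "card ({z. x \<rightarrow>\<^bsub>G\<^esub> z} \<inter> {z. y \<rightarrow>\<^bsub>G\<^esub> z}) = \<beta>"
      if y: "y \<in> verts G" "x \<noteq> y" "y \<notin> {z. x \<rightarrow>\<^bsub>G\<^esub> z}"
        and ne: "{z. x \<rightarrow>\<^bsub>G\<^esub> z} \<inter> {z. y \<rightarrow>\<^bsub>G\<^esub> z} \<noteq> {}"
    proof -
      obtain w where "x \<rightarrow>\<^bsub>G\<^esub> w" "w \<rightarrow>\<^bsub>G\<^esub> y"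
        using ne arcs_ends_symmetric[OF sym_arcs] by auto
      then have "graph_dist G x y = 2"
        using y by (intro graph_dist_eq_2 wf_digraph) auto
      then show ?thesis
        using G x y unfolding amply_regular_def common by blast
    qed
  qed
qed

lemma connected_closed_eq_verts:
  fixes G :: "('a, 'b) pre_digraph"
  assumes "graph G" "connected G"
    and S: "S \<subseteq> verts G" "S \<noteq> {}" "\<And>x y. x \<in> S \<Longrightarrow> x \<rightarrow>\<^bsub>G\<^esub> y \<Longrightarrow> y \<in> S"
  shows "S = verts G"
proof -
  interpret graph G
    by fact
  obtain s where s: "s \<in> S"
    using S by blast
  have "v \<in> S" if "v \<in> verts G" for v
  proof -
    \<comment> \<open>Connectedness is defined through the symmetric closure, which has the same
      reachability as the symmetric \<open>G\<close>.\<close>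
    have "s \<rightarrow>\<^sup>*\<^bsub>mk_symmetric G\<^esub> v"
      using assms(2) that s S(1) unfolding connected_def strongly_connected_def by auto
    then have "s \<rightarrow>\<^sup>*\<^bsub>G\<^esub> v"
      by (simp add: reachable_mk_symmetric_eq[OF sym_arcs])
    then show ?thesis
      using s S(3) by (induction rule: reachable_induct) auto
  qed
  then show ?thesis
    using S(1) by blast
qed

text \<open>A vertex at distance two from \<open>u\<close> exists, and its \<open>\<beta>\<close> common neighbours with \<open>u\<close> are neighbours of \<open>u\<close>.\<close>

lemma amply_regular_beta_le_degree:
  fixes G :: "('a, 'b) pre_digraph"
  assumes G: "amply_regular n d \<alpha> \<beta> G" and conn: "connected G"
    and not_complete: "\<not> complete_digraph n G"
  shows "\<beta> \<le> d"
proof -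
  interpret graph G
    using G by (simp add: amply_regular_def)
  let ?N = "\<lambda>x. {y. x \<rightarrow>\<^bsub>G\<^esub> y}"
  interpret amply_nhds "verts G" ?N d \<alpha> \<beta>
    using G by (rule amply_nhds_of_amply_regular)
  have "arcs_ends G \<subseteq> {(u, v). (u, v) \<in> verts G \<times> verts G \<and> u \<noteq> v}"
    using adj_in_verts adj_not_same by auto
  then obtain u v where uv: "u \<in> verts G" "v \<in> verts G" "u \<noteq> v" "\<not> u \<rightarrow>\<^bsub>G\<^esub> v"
    using G not_complete by (auto simp: complete_digraph_def amply_regular_def)
  have "insert u (?N u) \<noteq> verts G"
    using uv by auto
  \<comment> \<open>The closed neighbourhood of \<open>u\<close> misses \<open>v\<close>, so by
    connectedness some arc leaves it; its head \<open>z\<close> is at distance two from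
    \<open>u\<close>.\<close>
  then obtain w z where w: "w \<in> insert u (?N u)" "w \<rightarrow>\<^bsub>G\<^esub> z" "z \<notin> insert u (?N u)"
    using connected_closed_eq_verts[OF _ conn, of "insert u (?N u)"] uv(1) nhd_subset[OF uv(1)] graph_axioms
    by blast
  then have z: "z \<in> verts G" "u \<noteq> z" "z \<notin> ?N u" "w \<in> ?N u \<inter> ?N z"
    using adj_in_verts sym_arcs arcs_ends_symmetric by auto
  then have "\<beta> = card (?N u \<inter> ?N z)"
    using card_common_dist2[OF uv(1)] by blast
  also have "\<dots> \<le> card (?N u)"
    using finite_nhd[OF uv(1)] by (intro card_mono) auto
  finally show ?thesis
    using card_nhd[OF uv(1)] by simp
qed

theorem theorem5p10:
  fixes G :: "('a, 'b) pre_digraph" and n d \<alpha> \<beta> :: nat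
  assumes "amply_regular n d \<alpha> \<beta> G"
    and "connected G"
    and "\<not> complete_digraph n G"
    and "arcs G \<noteq> {}"
    and "\<beta> \<noteq> 1"
    and "\<beta> > \<alpha>"
  shows "expander n d
    (1 - real d / (real d + 4 +
       max (real \<alpha>)
           (2 * real_of_int \<lceil>(real \<beta> - real \<alpha>) * real \<alpha> / (real \<beta> - 1)\<rceil>))) G"
proof -
  interpret graph G
    using assms(1) by (simp add: amply_regular_def)
  interpret amply_nhds "verts G" "\<lambda>x. {y. x \<rightarrow>\<^bsub>G\<^esub> y}" d \<alpha> \<beta>
    using assms(1) by (rule amply_nhds_of_amply_regular)
  have card_verts: "card (verts G) = n" and degree: "\<And>v. v \<in> verts G \<Longrightarrow> out_degree G v = d"
    using assms(1) by (auto simp: amply_regular_def)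
  obtain e where e: "e \<in> arcs G"
    using assms(4) by blast
  define u v where "u = tail G e" and "v = head G e"
  have uv: "u \<in> verts G" "u \<rightarrow>\<^bsub>G\<^esub> v"
    using e by (auto simp: u_def v_def arcs_ends_conv)
  have "\<beta> \<le> d"
    using assms(1-3) by (rule amply_regular_beta_le_degree)
  \<comment> \<open>The chosen arc makes the vertex set nonempty, so the maximum degree is
    \<open>d\<close>.\<close>
  have "out_degree G ` verts G = {d}"
    using degree uv by auto
  moreover have "outer_nbrs G W = bdry W" for W
    by (auto simp: outer_nbrs_def bdry_def)
  moreover have "S = verts G"
    if "S \<subseteq> verts G" "S \<noteq> {}" "\<And>x. x \<in> S \<Longrightarrow> {y. x \<rightarrow>\<^bsub>G\<^esub> y} \<subseteq> S" for S
    using connected_closed_eq_verts[OF graph_axioms assms(2) that(1,2)] that(3) by blast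
  ultimately show ?thesis
    unfolding expander_def
    using graph_axioms card_verts uv(1) card_bdry_ge[OF _ uv(1) _ assms(5,6) \<open>\<beta> \<le> d\<close>, of v] uv(2)
    by auto
qed

end
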